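(* Let $P \subset \mathbb{R}^2$ be a convex integer polygon no two of whose sides are parallel, and let $l_1, l_2, \ldots, l_n$ be the affine lengths of its sides. Let $X$ be uniformly distributed in $[0,1]^2$ and let $X_P = |(P+X)\cap \mathbb{Z}^2|$. Then the variance of $X_P$ is $$\mathrm{Var}(X_P) = \frac{l_1^2 + l_2^2 + \cdots + l_n^2}{12}.$$
   Context: An integer polygon is a (closed, two-dimensional) polygon in $\mathbb{R}^2$ all of whose vertices have integer coordinates. For a compact set $C$, $C + X = \{c + X : c \in C\}$, and $|(C+X)\cap\mathbb{Z}^2|$ is the number of lattice points in the translate. The affine length of a side of an integer polygon is the number of segments into which the integer points on that side divide it; equivalently, if the side is the vector $(p,q) \in \mathbb{Z}^2\setminus\{0\}$, its affine length is $\gcd(p,q)$. *)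

theory Defs
  imports "HOL-Probability.Probability"
begin

definition int_lattice :: "(real ^ 2) set" where
  "int_lattice = {x. \<forall>i. x $ i \<in> \<int>}"

text \<open>Vertices are the extreme points, and sides are the one-dimensional faces
  (\<open>edge_of\<close>); hence no vertex has a straight angle, and a side is maximal on its line.\<close>

definition convex_integer_polygon :: "(real ^ 2) set \<Rightarrow> bool" where
  "convex_integer_polygon P \<longleftrightarrow>
     polytope P \<and> aff_dim P = 2 \<and> (\<forall>v. v extreme_point_of P \<longrightarrow> v \<in> int_lattice)"

definition sides :: "(real ^ 2) set \<Rightarrow> (real ^ 2) set set" where
  "sides P = {s. s edge_of P}"

definition parallel_sides :: "(real ^ 2) set \<Rightarrow> (real ^ 2) set \<Rightarrow> bool" where
  "parallel_sides s t \<longleftrightarrow> affine_parallel (affine hull s) (affine hull t)"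

text \<open>A segment with lattice endpoints containing \<open>k + 1\<close> lattice points in total is cut by
  them into \<open>k\<close> pieces.\<close>

definition affine_length :: "(real ^ 2) set \<Rightarrow> nat" where
  "affine_length s = card (s \<inter> int_lattice) - 1"

definition translate_count :: "(real ^ 2) set \<Rightarrow> real ^ 2 \<Rightarrow> nat" where
  "translate_count C x = card ((\<lambda>c. c + x) ` C \<inter> int_lattice)"

end

theory Submission
  imports Defs
begin

text \<open>
  Let \<open>\<psi> y = frac y - 1/2\<close>. Give each side \<open>e\<close> its primitive integer outward normal \<open>\<nu>\<close> and
  affine length \<open>l\<close>. Counting lattice points of \<open>P + x\<close> on a line parallel to the \<open>j\<close>-axis, the
  two ends of the slice of \<open>P\<close> lie on one side each and contribute a term \<open>- \<psi>\<close> each; summed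
  over all lines, a side with \<open>\<nu>\<^sub>j \<noteq> 0\<close> contributes \<open>- l \<psi> (\<nu> \<bullet> x)\<close>, because the values met run
  through all residues modulo \<open>\<nu>\<^sub>j\<close> exactly \<open>l\<close> times. The sides with \<open>\<nu>\<^sub>j = 0\<close> and the lengths of
  the slices depend on the other coordinate of \<open>x\<close> only. Hence \<open>h x = X\<^sub>P + (\<Sum> l \<psi> (\<nu> \<bullet> x))\<close> is a
  function of \<open>x\<^sub>1\<close> alone and of \<open>x\<^sub>2\<close> alone, so it is constant. The random variables
  \<open>\<psi> (\<nu> \<bullet> X)\<close> are centred with variance \<open>1/12\<close>, and uncorrelated for non-parallel \<open>\<nu>\<close>: averaging
  over a direction orthogonal to one normal but not to the other kills the product.
\<close>

subsection \<open>Means of periodic functions over the unit cube\<close>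

text \<open>Kept generic in the Euclidean space: the cube is the unit square for the law of
  \<open>X\<close> and the unit interval for averages along a line. Integrating an indicator over
  the whole space makes translation invariance of Lebesgue measure directly usable.\<close>

definition unit_mean :: "('a::euclidean_space \<Rightarrow> real) \<Rightarrow> real" where
  "unit_mean G = (\<integral>x. indicator (cbox 0 One) x * G x \<partial>lborel)"

lemma integrable_unit_cube:
  fixes G :: "'a::euclidean_space \<Rightarrow> real"
  assumes [measurable]: "G \<in> borel_measurable borel" and "\<And>x. \<bar>G x\<bar> \<le> B"
  shows "integrable lborel (\<lambda>x. indicator (cbox 0 One) x * G x)"
proof (rule integrableI_bounded_set[where A="cbox 0 One" and B=B])
  show "AE x\<in>cbox 0 One in lborel. norm (indicator (cbox 0 One) x * G x) \<le> B"
    using assms(2) by (auto simp: indicator_def)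
qed (use assms in \<open>auto simp: indicator_def emeasure_lborel_cbox_eq\<close>)

text \<open>Serves to discard faces of the cube and, later, points with an integer
  coordinate.\<close>

lemma AE_lborel_inner_neq:
  fixes a :: "'a::euclidean_space"
  assumes "a \<noteq> 0"
  shows "AE x in lborel. a \<bullet> x \<noteq> c"
proof -
  have "negligible {x. a \<bullet> x = c}"
    using assms by (intro negligible_hyperplane) auto
  then have "{x. a \<bullet> x = c} \<in> null_sets lebesgue"
    by (simp add: negligible_iff_null_sets)
  then have "{x. a \<bullet> x = c} \<in> null_sets lborel"
    by (subst (asm) null_sets_completion_iff) (auto intro: borel_closed closed_hyperplane)
  then show ?thesis
    by (auto dest: AE_not_in)
qed

lemma lborel_integral_translate:
  fixes f :: "'a::euclidean_space \<Rightarrow> real"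
  assumes [measurable]: "f \<in> borel_measurable borel"
  shows "(\<integral>x. f (x + c) \<partial>lborel) = (\<integral>x. f x \<partial>lborel)"
proof -
  have "(\<integral>x. f x \<partial>lborel) = (\<integral>x. f x \<partial>distr lborel borel ((+) c))"
    by (simp add: lborel_distr_plus)
  also have "\<dots> = (\<integral>x. f (c + x) \<partial>lborel)"
    by (rule integral_distr) auto
  finally show ?thesis by (simp add: add.commute)
qed

lemma lborel_integrable_translate:
  fixes f :: "'a::euclidean_space \<Rightarrow> real"
  assumes [measurable]: "f \<in> borel_measurable borel"
  shows "integrable lborel (\<lambda>x. f (x + c)) \<longleftrightarrow> integrable lborel f"
proof -
  have "integrable lborel f \<longleftrightarrow> integrable (distr lborel borel ((+) c)) f"
    by (simp only: lborel_distr_plus)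
  also have "\<dots> \<longleftrightarrow> integrable lborel (\<lambda>x. f (c + x))"
    by (rule integrable_distr_eq) auto
  finally show ?thesis by (simp add: add.commute)
qed

lemma periodic_of_int:
  fixes G :: "'a::real_vector \<Rightarrow> 'b"
  assumes "\<And>x. G (x + i) = G x"
  shows "G (x + of_int k *\<^sub>R i) = G x"
proof -
  have nat: "G (x + of_nat n *\<^sub>R i) = G x" for n x
  proof (induction n arbitrary: x)
    case (Suc n)
    have "G (x + of_nat (Suc n) *\<^sub>R i) = G ((x + of_nat n *\<^sub>R i) + i)"
      by (simp add: algebra_simps)
    then show ?case using Suc assms by simp
  qed auto
  show ?thesis
  proof (cases k)
    case (nonneg n) then show ?thesis using nat by simp
  next
    case (neg n)
    then have "x + of_int k *\<^sub>R i + of_nat (Suc n) *\<^sub>R i = x"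
      by (simp add: algebra_simps flip: scaleR_add_left)
    then show ?thesis using nat[of "x + of_int k *\<^sub>R i" "Suc n"] by metis
  qed
qed

text \<open>By periodicity only the fractional part \<open>a\<close> of \<open>r\<close> matters.
  The slab of the shifted cube that sticks out of the unit cube is moved back by one period and
  fills the gap left behind.\<close>

lemma unit_mean_shift_axis:
  fixes G :: "'a::euclidean_space \<Rightarrow> real"
  assumes i: "i \<in> Basis" and [measurable]: "G \<in> borel_measurable borel"
    and B: "\<And>x. \<bar>G x\<bar> \<le> B" and per: "\<And>x. G (x + i) = G x"
  shows "unit_mean (\<lambda>x. G (x + r *\<^sub>R i)) = unit_mean G"
proof -
  define a where "a = frac r"
  have a: "0 \<le> a" "a < 1" by (auto simp: a_def frac_ge_0 frac_lt_1)
  define Q :: "'a set" where "Q = cbox 0 One"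
  have [measurable]: "Q \<in> sets borel" by (simp add: Q_def)
  have Ga: "G (x + r *\<^sub>R i) = G (x + a *\<^sub>R i)" for x
    using periodic_of_int[of G i "x + a *\<^sub>R i" "\<lfloor>r\<rfloor>", OF per]
    by (simp add: a_def frac_def algebra_simps)
  have Ga': "G (x + a *\<^sub>R i) = G (x + (a - 1) *\<^sub>R i)" for x
    using per[of "x + (a - 1) *\<^sub>R i"] by (simp add: algebra_simps)
  \<comment> \<open>\<open>u\<close> lives on the part of the shifted cube with
    \<open>i\<close>-coordinate below 1, \<open>v\<close> on the remaining slab after moving it back
    by \<open>i\<close>.\<close>
  define u where "u y = indicator Q (y - a *\<^sub>R i) * indicator {y. y \<bullet> i < 1} y * G y" for y
  define v where "v y = indicator Q (y - (a - 1) *\<^sub>R i) * indicator {y. y \<bullet> i \<ge> 0} y * G y" for y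
  have [measurable]: "u \<in> borel_measurable borel" "v \<in> borel_measurable borel"
    unfolding u_def v_def by measurable
  have bound: "integrable lborel (\<lambda>x. indicator Q x * h x)"
    if [measurable]: "h \<in> borel_measurable borel" and "\<And>x. \<bar>h x\<bar> \<le> \<bar>G (x + c)\<bar>" for h :: "'a \<Rightarrow> real" and c
    unfolding Q_def by (rule integrable_unit_cube[where B=B]) (use that B order_trans in blast)+
  have split: "indicator Q x * G (x + r *\<^sub>R i) = u (x + a *\<^sub>R i) + v (x + (a - 1) *\<^sub>R i)" for x
    using i Ga'[of x] by (auto simp: Ga u_def v_def indicator_def inner_add_left)
  have iu: "integrable lborel (\<lambda>x. u (x + a *\<^sub>R i))"
    using bound[of "\<lambda>x. indicator {y. y \<bullet> i < 1} (x + a *\<^sub>R i) * G (x + a *\<^sub>R i)" "a *\<^sub>R i"]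
    by (simp add: u_def indicator_def mult.assoc cong: if_cong)
  have iv: "integrable lborel (\<lambda>x. v (x + (a - 1) *\<^sub>R i))"
    using bound[of "\<lambda>x. indicator {y. y \<bullet> i \<ge> 0} (x + (a - 1) *\<^sub>R i) * G (x + (a - 1) *\<^sub>R i)" "(a - 1) *\<^sub>R i"]
    by (simp add: v_def indicator_def mult.assoc cong: if_cong)
  have "unit_mean (\<lambda>x. G (x + r *\<^sub>R i)) = (\<integral>x. u (x + a *\<^sub>R i) \<partial>lborel) + (\<integral>x. v (x + (a - 1) *\<^sub>R i) \<partial>lborel)"
    unfolding unit_mean_def Q_def[symmetric] split by (rule Bochner_Integration.integral_add[OF iu iv])
  also have "\<dots> = (\<integral>x. u x \<partial>lborel) + (\<integral>x. v x \<partial>lborel)"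
    by (simp add: lborel_integral_translate)
  also have "\<dots> = (\<integral>x. u x + v x \<partial>lborel)"
  proof (rule Bochner_Integration.integral_add[symmetric])
    show "integrable lborel u" "integrable lborel v"
      using iu iv by (simp_all add: lborel_integrable_translate)
  qed
  also have "\<dots> = unit_mean G"
    unfolding unit_mean_def Q_def[symmetric]
  proof (rule integral_cong_AE)
    have "i \<noteq> 0" using i by auto
    \<comment> \<open>Equality fails only on two hyperplanes: at coordinate \<open>a\<close> both
      pieces are counted, at coordinate 1 neither is.\<close>
    show "AE x in lborel. u x + v x = indicator Q x * G x"
      using AE_lborel_inner_neq[OF \<open>i \<noteq> 0\<close>, of a] AE_lborel_inner_neq[OF \<open>i \<noteq> 0\<close>, of 1]
    proof eventually_elim
      case (elim x)
      have *: "x - c *\<^sub>R i \<in> Q \<longleftrightarrow> (0 \<le> x \<bullet> i - c \<and> x \<bullet> i - c \<le> 1) \<and> (\<forall>b\<in>Basis - {i}. 0 \<le> x \<bullet> b \<and> x \<bullet> b \<le> 1)" for c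
      proof -
        have "(x - c *\<^sub>R i) \<bullet> b = (if b = i then x \<bullet> i - c else x \<bullet> b)" if "b \<in> Basis" for b
          using that i by (auto simp: inner_diff_left inner_Basis)
        then show ?thesis using i by (auto simp: Q_def mem_box)
      qed
      have x: "x \<bullet> i \<noteq> a" "x \<bullet> i \<noteq> 1" using elim by (auto simp: inner_commute)
      show ?case
        using *[of a] *[of "a - 1"] *[of 0] x a by (auto simp: u_def v_def indicator_def)
    qed
  qed measurable
  finally show ?thesis .
qed

text \<open>The shift is carried out one basis direction at a time; a partially shifted function is
  still bounded and periodic.\<close>

lemma unit_mean_shift:
  fixes G :: "'a::euclidean_space \<Rightarrow> real"
  assumes "G \<in> borel_measurable borel" "\<And>x. \<bar>G x\<bar> \<le> B" "\<And>x i. i \<in> Basis \<Longrightarrow> G (x + i) = G x"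
  shows "unit_mean (\<lambda>x. G (x + a)) = unit_mean G"
proof -
  have "unit_mean (\<lambda>x. G (x + (\<Sum>i\<in>I. (a \<bullet> i) *\<^sub>R i))) = unit_mean G" if "finite I" "I \<subseteq> Basis" for I
    using that
  proof (induction I rule: finite_induct)
    case (insert i I)
    define H where "H x = G (x + (\<Sum>i\<in>I. (a \<bullet> i) *\<^sub>R i))" for x
    have "unit_mean (\<lambda>x. H (x + (a \<bullet> i) *\<^sub>R i)) = unit_mean H"
    proof (rule unit_mean_shift_axis)
      show "i \<in> Basis" using insert by auto
      have [measurable]: "G \<in> borel_measurable borel" by fact
      show "H \<in> borel_measurable borel" unfolding H_def by measurable
      show "\<bar>H x\<bar> \<le> B" for x using assms by (auto simp: H_def)
      show "H (x + i) = H x" for x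
        using assms(3)[OF \<open>i \<in> Basis\<close>, of "x + (\<Sum>i\<in>I. (a \<bullet> i) *\<^sub>R i)"]
        by (simp add: H_def algebra_simps)
    qed
    moreover have "unit_mean H = unit_mean G"
      using insert by (simp add: H_def[abs_def])
    ultimately show ?case using insert by (simp add: H_def algebra_simps)
  qed simp
  from this[of Basis] show ?thesis by (simp add: euclidean_representation)
qed

text \<open>Shifting by \<open>t *\<^sub>R v\<close> does not change the mean, so neither does
  averaging these shifts over \<open>t\<close> in the unit interval. Fubini then makes the average
  along \<open>v\<close> the inner integral. The direction \<open>v\<close> need not be a lattice
  vector.\<close>

lemma unit_mean_fubini:
  fixes G :: "'a::euclidean_space \<Rightarrow> real"
  assumes [measurable]: "G \<in> borel_measurable borel" and B: "\<And>x. \<bar>G x\<bar> \<le> B"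
    and per: "\<And>x i. i \<in> Basis \<Longrightarrow> G (x + i) = G x"
    and inner: "\<And>x. unit_mean (\<lambda>t::real. G (x + t *\<^sub>R v)) = J"
  shows "unit_mean G = J"
proof -
  let ?I = "\<lambda>t::real. indicator (cbox 0 1) t :: real" and ?Q = "\<lambda>x::'a. indicator (cbox 0 One) x :: real"
  have int: "integrable (lborel \<Otimes>\<^sub>M lborel) (\<lambda>(x, t). ?Q x * (?I t * G (x + t *\<^sub>R v)))"
  proof (rule integrableI_bounded_set[where A="cbox 0 One \<times> cbox 0 1" and B=B])
    show "emeasure (lborel \<Otimes>\<^sub>M lborel) (cbox 0 (One::'a) \<times> cbox 0 (1::real)) < \<infinity>"
      by (subst lborel.emeasure_pair_measure_Times)
        (auto simp: emeasure_lborel_cbox_eq ennreal_mult_less_top)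
    show "AE x\<in>cbox 0 One \<times> cbox 0 1 in lborel \<Otimes>\<^sub>M lborel. norm (case x of (x, t) \<Rightarrow> ?Q x * (?I t * G (x + t *\<^sub>R v))) \<le> B"
      using B by (auto simp: indicator_def)
  qed (auto simp: indicator_def)
  have m1: "unit_mean (\<lambda>x::real. c) = c" for c
    by (simp add: unit_mean_def)
  have mA: "unit_mean (\<lambda>x::'a. c) = c" for c
    by (simp add: unit_mean_def)
  have "J = unit_mean (\<lambda>x::'a. unit_mean (\<lambda>t::real. G (x + t *\<^sub>R v)))"
    by (simp add: inner mA)
  also have "\<dots> = (\<integral>x. \<integral>t. ?Q x * (?I t * G (x + t *\<^sub>R v)) \<partial>lborel \<partial>lborel)"
    by (simp add: unit_mean_def)
  also have "\<dots> = (\<integral>t. \<integral>x. ?Q x * (?I t * G (x + t *\<^sub>R v)) \<partial>lborel \<partial>lborel)"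
    by (rule lborel_pair.Fubini_integral[symmetric, OF int])
  also have "\<dots> = unit_mean (\<lambda>t::real. unit_mean (\<lambda>x. G (x + t *\<^sub>R v)))"
    by (simp add: unit_mean_def mult.left_commute)
  also have "\<dots> = unit_mean G"
    by (subst unit_mean_shift[OF assms(1) B per]) (simp_all add: m1)
  finally show ?thesis ..
qed

section \<open>Means and orthogonality of sawtooth functions\<close>

definition sawtooth :: "real \<Rightarrow> real" where
  "sawtooth y = frac y - 1/2"

lemma sawtooth_add_int [simp]: "k \<in> \<int> \<Longrightarrow> sawtooth (y + k) = sawtooth y"
  by (auto simp: sawtooth_def frac_def elim!: Ints_cases)

lemma abs_sawtooth_le: "\<bar>sawtooth y\<bar> \<le> 1"
  using frac_ge_0[of y] frac_lt_1[of y] unfolding sawtooth_def by linarith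

lemma measurable_sawtooth [measurable]: "sawtooth \<in> borel_measurable borel"
  unfolding sawtooth_def[abs_def] frac_def by measurable

lemma unit_mean_sawtooth:
  "unit_mean sawtooth = 0" "unit_mean (\<lambda>t. (sawtooth t)\<^sup>2) = 1/12"
proof -
  have eq: "AE t in lborel. indicator (cbox 0 1) t * f (sawtooth t) = indicator {0..1} t * f (t - 1/2)" for f :: "real \<Rightarrow> real"
    using AE_lborel_singleton[of 1]
    by eventually_elim (auto simp: indicator_def sawtooth_def frac_eq)
  have "unit_mean sawtooth = (\<integral>t. indicator {0..1} t * (t - 1/2) \<partial>lborel)"
    unfolding unit_mean_def using eq[of "\<lambda>t. t"]
    by (intro integral_cong_AE) auto
  also have "\<dots> = (\<integral>t. (t - 1/2) * indicator {0..1} t \<partial>lborel)"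
    by (simp add: mult.commute)
  also have "\<dots> = (1 - 1/2)\<^sup>2/2 - (0 - 1/2)\<^sup>2/2"
    by (rule integral_FTC_Icc_real[where F="\<lambda>t. (t - 1/2)\<^sup>2/2"])
      (auto intro!: derivative_eq_intros continuous_intros)
  finally show "unit_mean sawtooth = 0" by simp
  have "unit_mean (\<lambda>t. (sawtooth t)\<^sup>2) = (\<integral>t. indicator {0..1} t * (t - 1/2)\<^sup>2 \<partial>lborel)"
    unfolding unit_mean_def using eq[of "\<lambda>t. t\<^sup>2"]
    by (intro integral_cong_AE) auto
  also have "\<dots> = (\<integral>t. (t - 1/2)\<^sup>2 * indicator {0..1} t \<partial>lborel)"
    by (simp add: mult.commute)
  also have "\<dots> = (1 - 1/2)^3/3 - (0 - 1/2)^3/3"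
    by (rule integral_FTC_Icc_real[where F="\<lambda>t. (t - 1/2)^3/3"])
      (auto intro!: derivative_eq_intros continuous_intros)
  finally show "unit_mean (\<lambda>t. (sawtooth t)\<^sup>2) = 1/12" by (simp add: power3_eq_cube)
qed

lemma unit_mean_sum:
  fixes F :: "'b \<Rightarrow> 'a::euclidean_space \<Rightarrow> real"
  assumes "\<And>i. i \<in> I \<Longrightarrow> F i \<in> borel_measurable borel" "\<And>i x. i \<in> I \<Longrightarrow> \<bar>F i x\<bar> \<le> B i"
  shows "unit_mean (\<lambda>x. \<Sum>i\<in>I. F i x) = (\<Sum>i\<in>I. unit_mean (F i))"
  unfolding unit_mean_def sum_distrib_left
  by (rule Bochner_Integration.integral_sum) (use assms integrable_unit_cube in blast)

lemma unit_mean_cmult: "unit_mean (\<lambda>x. c * G x) = c * unit_mean G"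
  by (simp add: unit_mean_def mult.left_commute)

text \<open>Along the direction \<open>n /\<^sub>R (n \<bullet> n)\<close> the argument
  \<open>n \<bullet> x\<close> grows at unit speed, so the inner average is a one-dimensional mean
  of a shift of \<open>g\<close>.\<close>

lemma unit_mean_inner:
  fixes n :: "'a::euclidean_space" and g :: "real \<Rightarrow> real"
  assumes "n \<noteq> 0" and n: "\<And>i. i \<in> Basis \<Longrightarrow> n \<bullet> i \<in> \<int>"
    and g: "g \<in> borel_measurable borel" "\<And>y. \<bar>g y\<bar> \<le> B" and per: "\<And>y k. k \<in> \<int> \<Longrightarrow> g (y + k) = g y"
  shows "unit_mean (\<lambda>x. g (n \<bullet> x)) = unit_mean g"
proof (rule unit_mean_fubini[where v="n /\<^sub>R (n \<bullet> n)" and B=B])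
  note [measurable] = g(1)
  show "(\<lambda>x. g (n \<bullet> x)) \<in> borel_measurable borel" by measurable
  show "g (n \<bullet> (x + i)) = g (n \<bullet> x)" if "i \<in> Basis" for x i
    using n[OF that] by (simp add: inner_add_right per)
  show "unit_mean (\<lambda>t. g (n \<bullet> (x + t *\<^sub>R (n /\<^sub>R (n \<bullet> n))))) = unit_mean g" for x
    using unit_mean_shift[of g B "n \<bullet> x"] g per \<open>n \<noteq> 0\<close>
    by (simp add: inner_add_right add.commute mult.assoc)
qed (use g in auto)

lemma unit_mean_sawtooth_inner:
  fixes n :: "'a::euclidean_space"
  assumes "n \<noteq> 0" "\<And>i. i \<in> Basis \<Longrightarrow> n \<bullet> i \<in> \<int>"
  shows "unit_mean (\<lambda>x. sawtooth (n \<bullet> x)) = 0" "unit_mean (\<lambda>x. (sawtooth (n \<bullet> x))\<^sup>2) = 1/12"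
proof -
  show "unit_mean (\<lambda>x. sawtooth (n \<bullet> x)) = 0"
    using unit_mean_inner[OF assms, of sawtooth 1] by (simp add: abs_sawtooth_le unit_mean_sawtooth)
  have "unit_mean (\<lambda>x. (sawtooth (n \<bullet> x))\<^sup>2) = unit_mean (\<lambda>t. (sawtooth t)\<^sup>2)"
    by (rule unit_mean_inner[OF assms, of _ 1]) (auto simp: abs_sawtooth_le abs_square_le_1)
  then show "unit_mean (\<lambda>x. (sawtooth (n \<bullet> x))\<^sup>2) = 1/12" by (simp add: unit_mean_sawtooth)
qed

text \<open>Along \<open>v\<close> the first factor is frozen while the second runs through one full
  period, whose mean is 0.\<close>

lemma unit_mean_sawtooth_mult:
  fixes m n :: "'a::euclidean_space"
  assumes m: "\<And>i. i \<in> Basis \<Longrightarrow> m \<bullet> i \<in> \<int>" and n: "\<And>i. i \<in> Basis \<Longrightarrow> n \<bullet> i \<in> \<int>"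
    and v: "m \<bullet> v = 0" "n \<bullet> v = 1"
  shows "unit_mean (\<lambda>x. sawtooth (m \<bullet> x) * sawtooth (n \<bullet> x)) = 0"
proof (rule unit_mean_fubini[where v=v and B=1])
  show "\<bar>sawtooth (m \<bullet> x) * sawtooth (n \<bullet> x)\<bar> \<le> 1" for x
    using mult_mono[OF abs_sawtooth_le[of "m \<bullet> x"] abs_sawtooth_le[of "n \<bullet> x"]] by (simp add: abs_mult)
  show "sawtooth (m \<bullet> (x + i)) * sawtooth (n \<bullet> (x + i)) = sawtooth (m \<bullet> x) * sawtooth (n \<bullet> x)"
    if "i \<in> Basis" for x i
    using m[OF that] n[OF that] by (simp add: inner_add_right)
  show "unit_mean (\<lambda>t. sawtooth (m \<bullet> (x + t *\<^sub>R v)) * sawtooth (n \<bullet> (x + t *\<^sub>R v))) = 0" for x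
    using unit_mean_shift[of sawtooth 1 "n \<bullet> x"] v
    by (simp add: inner_add_right unit_mean_cmult abs_sawtooth_le unit_mean_sawtooth add.commute)
qed measurable

text \<open>The square is expanded into a double sum, in which only the diagonal survives. Linear
  independence of two normals is assumed in the form of the vector \<open>v\<close> that
  \<open>unit_mean_sawtooth_mult\<close> consumes.\<close>

lemma unit_mean_sawtooth_sum_square:
  fixes n :: "'b \<Rightarrow> 'a::euclidean_space" and l :: "'b \<Rightarrow> real"
  assumes "finite E" and ne: "\<And>e. e \<in> E \<Longrightarrow> n e \<noteq> 0"
    and n: "\<And>e i. e \<in> E \<Longrightarrow> i \<in> Basis \<Longrightarrow> n e \<bullet> i \<in> \<int>"
    and indep: "\<And>e e'. e \<in> E \<Longrightarrow> e' \<in> E \<Longrightarrow> e \<noteq> e' \<Longrightarrow> \<exists>v. n e \<bullet> v = 0 \<and> n e' \<bullet> v = 1"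
  shows "unit_mean (\<lambda>x. \<Sum>e\<in>E. l e * sawtooth (n e \<bullet> x)) = 0"
    and "unit_mean (\<lambda>x. (\<Sum>e\<in>E. l e * sawtooth (n e \<bullet> x))\<^sup>2) = (\<Sum>e\<in>E. (l e)\<^sup>2) / 12"
proof -
  have "unit_mean (\<lambda>x. \<Sum>e\<in>E. l e * sawtooth (n e \<bullet> x)) = (\<Sum>e\<in>E. unit_mean (\<lambda>x. l e * sawtooth (n e \<bullet> x)))"
    by (rule unit_mean_sum[where B="\<lambda>e. \<bar>l e\<bar>"])
      (auto simp: abs_mult abs_sawtooth_le mult_left_le)
  then show "unit_mean (\<lambda>x. \<Sum>e\<in>E. l e * sawtooth (n e \<bullet> x)) = 0"
    using ne n by (simp add: unit_mean_cmult unit_mean_sawtooth_inner)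
  let ?s = "\<lambda>e x. sawtooth (n e \<bullet> x)"
  have *: "unit_mean (\<lambda>x. ?s e x * ?s e' x) = (if e = e' then 1/12 else 0)" if "e \<in> E" "e' \<in> E" for e e'
    using that unit_mean_sawtooth_inner(2)[of "n e"] ne n indep[of e e'] unit_mean_sawtooth_mult[of "n e" "n e'"]
    by (auto simp: power2_eq_square)
  have b: "\<bar>?s e x * ?s e' x\<bar> \<le> 1" for e e' x
    using mult_mono[OF abs_sawtooth_le[of "n e \<bullet> x"] abs_sawtooth_le[of "n e' \<bullet> x"]] by (simp add: abs_mult)
  have "unit_mean (\<lambda>x. (\<Sum>e\<in>E. l e * ?s e x)\<^sup>2)
      = unit_mean (\<lambda>x. \<Sum>(e, e')\<in>E \<times> E. (l e * l e') * (?s e x * ?s e' x))"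
    by (simp add: power2_eq_square sum_product sum.cartesian_product mult_ac)
  also have "\<dots> = (\<Sum>p\<in>E \<times> E. unit_mean (\<lambda>x. case p of (e, e') \<Rightarrow> (l e * l e') * (?s e x * ?s e' x)))"
  proof (rule unit_mean_sum[where B="\<lambda>(e, e'). \<bar>l e * l e'\<bar>"])
    fix p x
    show "\<bar>case p of (e, e') \<Rightarrow> (l e * l e') * (?s e x * ?s e' x)\<bar> \<le> (case p of (e, e') \<Rightarrow> \<bar>l e * l e'\<bar>)"
      using mult_left_le[OF b, of "\<bar>l (fst p) * l (snd p)\<bar>" "fst p" x "snd p"]
      by (auto simp: abs_mult split: prod.split)
  qed (auto split: prod.split)
  also have "\<dots> = (\<Sum>(e, e')\<in>E \<times> E. (l e * l e') * (if e = e' then 1/12 else 0))"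
    by (rule sum.cong) (auto simp: unit_mean_cmult *)
  also have "\<dots> = (\<Sum>e\<in>E. \<Sum>e'\<in>E. (l e * l e') * (if e = e' then 1/12 else 0))"
    by (simp add: sum.cartesian_product)
  also have "\<dots> = (\<Sum>e\<in>E. (l e)\<^sup>2) / 12"
    using \<open>finite E\<close> by (simp add: if_distrib sum.delta' sum_divide_distrib power2_eq_square cong: if_cong)
  finally show "unit_mean (\<lambda>x. (\<Sum>e\<in>E. l e * sawtooth (n e \<bullet> x))\<^sup>2) = (\<Sum>e\<in>E. (l e)\<^sup>2) / 12" .
qed

subsection \<open>Sums of the sawtooth function over residues\<close>

text \<open>This is the distribution relation of the first periodic Bernoulli function. Since
  \<open>n\<close> is invertible modulo \<open>m\<close>, the integers
  \<open>\<lfloor>t\<rfloor> + n * k\<close> meet every residue once, and the sum becomes an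
  arithmetic progression.\<close>

lemma sum_sawtooth_period:
  fixes n K :: int and m :: nat and t :: real
  assumes "m > 0" "coprime n (int m)"
  shows "(\<Sum>k\<in>{K..<K + int m}. sawtooth ((t + of_int (n * k)) / real m)) = sawtooth t"
proof -
  let ?r = "\<lambda>k. (\<lfloor>t\<rfloor> + n * k) mod int m"
  have inj: "inj_on ?r {K..<K + int m}"
  proof (rule inj_onI)
    fix k k' assume k: "k \<in> {K..<K + int m}" "k' \<in> {K..<K + int m}" and "?r k = ?r k'"
    then have "int m dvd n * k - n * k'" by (auto simp: mod_eq_dvd_iff)
    then have "int m dvd k - k'"
      using assms by (simp add: coprime_commute coprime_dvd_mult_right_iff flip: right_diff_distrib)
    moreover have "\<bar>k - k'\<bar> < int m" using k by auto
    ultimately show "k = k'" using zdvd_not_zless by (metis zdvd_imp_le abs_of_nonneg dvd_abs_iff eq_iff_diff_eq_0 leD zero_less_abs_iff)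
  qed
  have img: "?r ` {K..<K + int m} = {0..<int m}"
    by (rule card_subset_eq) (use assms inj in \<open>auto simp: card_image\<close>)
  have eq: "sawtooth ((t + of_int (n * k)) / real m) = (of_int (?r k) + frac t) / real m - 1/2" for k
  proof -
    \<comment> \<open>\<open>q\<close> is the integer part of the argument: what remains,
      \<open>(?r k + frac t) / m\<close>, lies in [0, 1) because the residue is at most
      \<open>m - 1\<close>.\<close>
    define q where "q = (\<lfloor>t\<rfloor> + n * k) div int m"
    have "\<lfloor>t\<rfloor> + n * k = q * int m + ?r k" by (simp add: q_def)
    then have "of_int (\<lfloor>t\<rfloor> + n * k) = (of_int (q * int m + ?r k) :: real)" by (rule arg_cong)
    then have t: "(t + of_int (n * k)) / real m = (of_int (?r k) + frac t) / real m + of_int q"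
      using assms by (simp add: frac_def field_simps)
    have "?r k \<le> int m - 1" using assms by simp
    then have "real_of_int (?r k) \<le> real m - 1" by linarith
    then have "real_of_int (?r k) + frac t < real m" using frac_lt_1[of t] by linarith
    moreover have "real_of_int (?r k) \<ge> 0" using assms by simp
    ultimately have "frac ((of_int (?r k) + frac t) / real m) = (of_int (?r k) + frac t) / real m"
      using assms by (simp add: frac_eq)
    then show ?thesis unfolding t by (simp add: sawtooth_def)
  qed
  have "(\<Sum>k\<in>{K..<K + int m}. sawtooth ((t + of_int (n * k)) / real m))
      = (\<Sum>i\<in>?r ` {K..<K + int m}. (of_int i + frac t) / real m - 1/2)"
    unfolding eq by (simp add: sum.reindex[OF inj])
  also have "\<dots> = (\<Sum>i\<in>int ` {0..<m}. (of_int i + frac t) / real m - 1/2)"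
    by (simp add: img image_int_atLeastLessThan)
  also have "\<dots> = (\<Sum>i=0..<m. (real i + frac t) / real m - 1/2)"
    by (subst sum.reindex) auto
  also have "\<dots> = ((\<Sum>i=0..<m. real i) + m * frac t) / m - m / 2"
    by (simp add: sum_subtractf sum.distrib flip: sum_divide_distrib)
  also have "(\<Sum>i=0..<m. real i) = real m * (real m - 1) / 2"
    by (induction m) (auto simp: field_simps)
  also have "(real m * (real m - 1) / 2 + m * frac t) / m - m / 2 = sawtooth t"
    using assms by (simp add: field_simps sawtooth_def)
  finally show ?thesis .
qed

text \<open>Splits the range into \<open>l\<close> periods; later \<open>l\<close> is the affine
  length of a side and \<open>m\<close> the absolute value of one coordinate of its normal.\<close>

lemma sum_sawtooth_periods:
  fixes n K :: int and m l :: nat and t :: real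
  assumes "m > 0" "coprime n (int m)"
  shows "(\<Sum>k\<in>{K..<K + int (l * m)}. sawtooth ((t + of_int (n * k)) / real m)) = l * sawtooth t"
proof (induction l)
  case (Suc l)
  have "{K..<K + int (Suc l * m)} = {K..<K + int (l * m)} \<union> {K + int (l * m)..<K + int (l * m) + int m}"
    by (subst ivl_disj_un_two(3)) (auto simp: algebra_simps)
  then have "(\<Sum>k\<in>{K..<K + int (Suc l * m)}. sawtooth ((t + of_int (n * k)) / real m))
     = (\<Sum>k\<in>{K..<K + int (l * m)}. sawtooth ((t + of_int (n * k)) / real m))
      + (\<Sum>k\<in>{K + int (l * m)..<K + int (l * m) + int m}. sawtooth ((t + of_int (n * k)) / real m))"
    by (simp only:) (rule sum.union_disjoint, auto)
  then show ?case
    unfolding Suc sum_sawtooth_period[OF assms] by (simp add: algebra_simps)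
qed simp

subsection \<open>Sides of an integer polygon\<close>

text \<open>Lattice vectors are carried by their integer coordinates, so that coprimality and
  divisibility can be stated in \<open>int\<close>.\<close>

definition int_vec :: "(2 \<Rightarrow> int) \<Rightarrow> real ^ 2" where
  "int_vec N = (\<chi> k. real_of_int (N k))"

lemma int_vec_nth [simp]: "int_vec N $ k = of_int (N k)"
  by (simp add: int_vec_def)

text \<open>Formulated for both orders of the two indices, because the slicing argument is run once
  along each axis.\<close>

lemma inner_2:
  fixes x y :: "real ^ 2" and i j :: 2
  assumes "i \<noteq> j"
  shows "x \<bullet> y = x $ i * y $ i + x $ j * y $ j"
  using assms exhaust_2[of i] exhaust_2[of j] by (auto simp: inner_vec_def sum_2)

lemma int_lattice_conv: "int_lattice = range int_vec"
proof -
  have "\<exists>N. x = int_vec N" if "x \<in> int_lattice" for x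
    using that by (intro exI[of _ "\<lambda>k. \<lfloor>x $ k\<rfloor>"]) (auto simp: int_lattice_def vec_eq_iff)
  then show ?thesis by (auto simp: int_lattice_def image_iff)
qed

lemma edge_of_polytope_segment:
  assumes "polytope P" "e edge_of P"
  obtains a b where "e = closed_segment a b" "a \<noteq> b" "a extreme_point_of P" "b extreme_point_of P"
proof -
  have e: "e face_of P" "aff_dim e = 1" using assms by (auto simp: edge_of_def)
  then have "polytope e" using assms face_of_polytope_polytope by blast
  moreover have "e \<noteq> {}" using e by auto
  ultimately obtain a b where ab: "e = closed_segment a b"
    using e by (metis compact_convex_collinear_segment collinear_aff_dim order_refl polytope_imp_compact polytope_imp_convex)
  moreover have "a \<noteq> b" using ab e by auto
  moreover have "a extreme_point_of e" "b extreme_point_of e"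
    by (auto simp: ab extreme_point_of_segment)
  ultimately show ?thesis using that e extreme_point_of_face by blast
qed

text \<open>The lattice points are exactly \<open>a + t p\<close> for \<open>t = 0..g\<close>:
  primitivity of \<open>p\<close> rules out any lattice point between two consecutive ones.\<close>

lemma segment_lattice_points:
  fixes p :: "2 \<Rightarrow> int" and g :: nat
  assumes "coprime (p 1) (p 2)" "b - a = real g *\<^sub>R int_vec p" "a \<in> int_lattice"
  shows "card (closed_segment a b \<inter> int_lattice) = g + 1"
proof -
  have p: "int_vec p \<noteq> 0"
    using assms(1) by (auto simp: vec_eq_iff forall_2)
  have b: "b = a + real g *\<^sub>R int_vec p" using assms(2) by (simp add: algebra_simps)
  have "closed_segment a b \<inter> int_lattice = (\<lambda>t. a + real t *\<^sub>R int_vec p) ` {..g}" (is "?L = ?R")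
  proof (intro equalityI subsetI)
    fix y assume y: "y \<in> ?L"
    then obtain u where u: "0 \<le> u" "u \<le> 1" "y = (1 - u) *\<^sub>R a + u *\<^sub>R b"
      by (auto simp: in_segment)
    then have y2: "y = a + (u * g) *\<^sub>R int_vec p" by (simp add: b algebra_simps)
    have "y - a \<in> int_lattice" using y assms(3) by (auto simp: int_lattice_def)
    then have z: "u * g * of_int (p k) \<in> \<int>" for k
      by (simp add: y2 int_lattice_def)
    obtain r s where rs: "r * p 1 + s * p 2 = 1"
      using bezout_int[of "p 1" "p 2"] assms(1) by (auto simp: coprime_iff_gcd_eq_1)
    \<comment> \<open>A Bezout combination recovers \<open>u * g\<close> from its products with the
      two coordinates of \<open>p\<close>, which are integers.\<close>
    have "of_int r * (u * g * of_int (p 1)) + of_int s * (u * g * of_int (p 2)) \<in> \<int>"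
      by (intro Ints_add Ints_mult Ints_of_int z)
    also have "of_int r * (u * g * of_int (p 1)) + of_int s * (u * g * of_int (p 2)) = u * g * of_int (r * p 1 + s * p 2)"
      by (simp add: algebra_simps)
    finally have "u * g \<in> \<int>" by (simp only: rs) simp
    then obtain t where t: "u * g = of_int t" by (auto elim: Ints_cases)
    have "0 \<le> u * g" "u * g \<le> g" using u by (auto intro: mult_left_le_one_le)
    then have "0 \<le> t" "t \<le> int g" unfolding t by linarith+
    then show "y \<in> ?R" using y2 t by (intro image_eqI[of _ _ "nat t"]) auto
  next
    fix y assume "y \<in> ?R"
    then obtain t where t: "t \<le> g" "y = a + real t *\<^sub>R int_vec p" by auto
    \<comment> \<open>For \<open>g = 0\<close> the quotient is 0 by convention, which is right since
      then \<open>t = 0\<close>.\<close>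
    have "y = (1 - t / g) *\<^sub>R a + (t / g) *\<^sub>R b"
      using t by (cases "g = 0") (auto simp: b algebra_simps)
    moreover have "0 \<le> real t / g" "real t / g \<le> 1" using t by (auto simp: divide_le_eq_1)
    ultimately have "y \<in> closed_segment a b"
      unfolding in_segment by (intro exI[of _ "real t / g"] conjI)
    moreover have "y \<in> int_lattice" using t assms(3) by (auto simp: int_lattice_def)
    ultimately show "y \<in> ?L" by blast
  qed
  moreover have "inj_on (\<lambda>t. a + real t *\<^sub>R int_vec p) {..g}"
    using p by (auto intro: inj_onI)
  ultimately show ?thesis by (simp add: card_image)
qed

text \<open>With \<open>p\<close> the primitive direction of the side, the supporting functional is
  a multiple of \<open>p\<close> turned by a quarter turn; \<open>N\<close> is the primitive vector
  on that ray. The turn swaps coordinates, so the projection to axis \<open>i\<close> has length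
  \<open>g * \<bar>p i\<bar>\<close>, that is, affine length times
  \<open>\<bar>N j\<bar>\<close>.\<close>

lemma edge_normal:
  assumes P: "convex_integer_polygon P" and e: "e edge_of P"
  obtains N :: "2 \<Rightarrow> int" and c :: int where
    "coprime (N 1) (N 2)"
    "\<And>y. y \<in> P \<Longrightarrow> int_vec N \<bullet> y \<le> of_int c"
    "e = {y \<in> P. int_vec N \<bullet> y = of_int c}"
    "affine hull e = {y. int_vec N \<bullet> y = of_int c}"
    "\<And>i j. i \<noteq> j \<Longrightarrow> \<exists>A::int. (\<lambda>y. y $ i) ` e = {of_int A..of_int (A + int (affine_length e) * \<bar>N j\<bar>)}"
proof -
  have poly: "polytope P" and dim: "aff_dim P = 2"
    and vert: "\<And>v. v extreme_point_of P \<Longrightarrow> v \<in> int_lattice"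
    using P by (auto simp: convex_integer_polygon_def)
  obtain a b where ab: "e = closed_segment a b" "a \<noteq> b" "a \<in> int_lattice" "b \<in> int_lattice"
    using edge_of_polytope_segment[OF poly e] vert by metis
  obtain al bl where al: "a = int_vec al" and bl: "b = int_vec bl"
    using ab by (auto simp: int_lattice_conv)
  define g where "g = gcd (bl 1 - al 1) (bl 2 - al 2)"
  have "bl 1 - al 1 \<noteq> 0 \<or> bl 2 - al 2 \<noteq> 0"
    using \<open>a \<noteq> b\<close> by (auto simp: al bl vec_eq_iff forall_2)
  then have g: "g > 0" by (auto simp: g_def)
  define p :: "2 \<Rightarrow> int" where "p k = (bl k - al k) div g" for k
  have gp: "bl k - al k = g * p k" for k
    using exhaust_2[of k] by (auto simp: p_def g_def)
  have cop: "coprime (p 1) (p 2)"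
    unfolding p_def g_def by (rule div_gcd_coprime) fact
  have ba: "b - a = real (nat g) *\<^sub>R int_vec p"
    using g gp by (auto simp: al bl vec_eq_iff simp flip: of_int_mult of_int_diff)
  have len: "int (affine_length e) = g"
    using segment_lattice_points[OF cop ba ab(3)] g by (simp add: affine_length_def ab)
  obtain r s where rs: "r * p 1 + s * p 2 = 1"
    using bezout_int[of "p 1" "p 2"] cop by (auto simp: coprime_iff_gcd_eq_1)
  then have rs': "of_int r * of_int (p 1) + of_int s * of_int (p 2) = (1::real)"
    by (metis of_int_1 of_int_add of_int_mult)
  have face: "e face_of P" "aff_dim e = 1" using e by (auto simp: edge_of_def)
  then have "e exposed_face_of P"
    using poly by (simp add: exposed_face_of_polyhedron polytope_imp_polyhedron)
  then obtain w q where w: "P \<subseteq> {x. w \<bullet> x \<le> q}" "e = P \<inter> {x. w \<bullet> x = q}"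
    by (auto simp: exposed_face_of_def)
  have "a \<in> e" "b \<in> e" by (auto simp: ab)
  then have wab: "w \<bullet> a = q" "w \<bullet> b = q" using w by auto
  \<comment> \<open>Otherwise \<open>q = 0\<close> and the face would be all of \<open>P\<close>,
    which has dimension 2.\<close>
  have "w \<noteq> 0" using w wab face dim by auto
  have "w \<bullet> (b - a) = 0" using wab by (simp add: inner_diff_right)
  then have orth: "w $ 1 * of_int (p 1) + w $ 2 * of_int (p 2) = 0"
    using g by (simp add: ba inner_2[of 1 2])
  \<comment> \<open>The scalar with \<open>w = lam * (- p 2, p 1)\<close>, isolated by the Bezout
    identity for \<open>p\<close>.\<close>
  define lam where "lam = of_int r * w $ 2 - of_int s * w $ 1"
  have w1: "w $ 1 = - lam * of_int (p 2)" and w2: "w $ 2 = lam * of_int (p 1)"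
    using orth rs' unfolding lam_def by algebra+
  have lam: "lam \<noteq> 0" using \<open>w \<noteq> 0\<close> w1 w2 by (auto simp: vec_eq_iff forall_2)
  \<comment> \<open>Only the sign of \<open>lam\<close> is kept, so that \<open>N\<close> is a
    positive multiple of \<open>w\<close> and points outward.\<close>
  define \<sigma> :: int where "\<sigma> = (if lam > 0 then 1 else -1)"
  have sg: "lam = of_int \<sigma> * \<bar>lam\<bar>" "\<bar>\<sigma>\<bar> = 1" by (auto simp: \<sigma>_def)
  define N :: "2 \<Rightarrow> int" where "N k = (if k = 1 then - \<sigma> * p 2 else \<sigma> * p 1)" for k
  have wN: "w = \<bar>lam\<bar> *\<^sub>R int_vec N"
    using w1 w2 by (auto simp: vec_eq_iff forall_2 N_def \<sigma>_def)
  define c where "c = (\<Sum>k\<in>UNIV. N k * al k)"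
  have c: "of_int c = int_vec N \<bullet> a"
    by (simp add: c_def al inner_vec_def)
  then have q: "q = \<bar>lam\<bar> * of_int c" using wab by (simp add: wN)
  have Nabs: "\<bar>N j\<bar> = \<bar>p i\<bar>" if "i \<noteq> j" for i j
    using that exhaust_2[of i] exhaust_2[of j] sg by (auto simp: N_def abs_mult)
  show ?thesis
  proof
    show "coprime (N 1) (N 2)"
      using cop by (auto simp: N_def \<sigma>_def coprime_commute)
    show "int_vec N \<bullet> y \<le> of_int c" if "y \<in> P" for y
      using w(1) that lam by (auto simp: wN q)
    show "e = {y \<in> P. int_vec N \<bullet> y = of_int c}"
      using w(2) lam by (auto simp: wN q)
    show "affine hull e = {y. int_vec N \<bullet> y = of_int c}"
    proof -
      have "affine hull e = {u *\<^sub>R a + v *\<^sub>R b |u v. u + v = 1}"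
        by (simp add: ab segment_convex_hull affine_hull_2)
      also have "\<dots> = {y. int_vec N \<bullet> y = of_int c}"
      proof (intro equalityI subsetI)
        fix y assume "y \<in> {u *\<^sub>R a + v *\<^sub>R b |u v. u + v = 1}"
        then obtain u v where "y = u *\<^sub>R a + v *\<^sub>R b" "u + v = 1" by auto
        moreover have "int_vec N \<bullet> b = of_int c" using wab lam by (auto simp: wN q)
        ultimately show "y \<in> {y. int_vec N \<bullet> y = of_int c}"
          using c by (auto simp: inner_add_right simp flip: distrib_right)
      next
        fix y assume "y \<in> {y. int_vec N \<bullet> y = of_int c}"
        then have "int_vec N \<bullet> (y - a) = 0" using c by (simp add: inner_diff_right)
        then have o: "of_int (p 1) * (y - a) $ 2 = of_int (p 2) * (y - a) $ 1"
          using sg(2) by (auto simp: inner_2[of 1 2] N_def \<sigma>_def split: if_splits)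
        \<comment> \<open>The coefficient of \<open>y - a\<close> along \<open>p\<close>, again by
          Bezout; dividing by \<open>g\<close> gives the parameter with respect to
          \<open>b - a\<close>.\<close>
        define q where "q = of_int r * (y - a) $ 1 + of_int s * (y - a) $ 2"
        define t where "t = q / of_int g"
        have "(y - a) $ 1 = q * of_int (p 1)" "(y - a) $ 2 = q * of_int (p 2)"
          using o rs' unfolding q_def by algebra+
        then have "y - a = t *\<^sub>R (b - a)"
          using g by (auto simp: ba t_def vec_eq_iff forall_2)
        then have "y = (1 - t) *\<^sub>R a + t *\<^sub>R b" by (simp add: algebra_simps)
        then show "y \<in> {u *\<^sub>R a + v *\<^sub>R b |u v. u + v = 1}"
          by (intro CollectI exI[of _ "1 - t"] exI[of _ t]) auto
      qed
      finally show ?thesis .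
    qed
    show "\<exists>A::int. (\<lambda>y. y $ i) ` e = {of_int A..of_int (A + int (affine_length e) * \<bar>N j\<bar>)}"
      if "i \<noteq> j" for i j
    proof (rule exI[of _ "min (al i) (bl i)"])
      have "min (al i) (bl i) + int (affine_length e) * \<bar>N j\<bar> = min (al i) (bl i) + \<bar>bl i - al i\<bar>"
        using g by (simp add: len Nabs[OF that] gp abs_mult)
      also have "\<dots> = max (al i) (bl i)" by auto
      finally have m: "min (al i) (bl i) + int (affine_length e) * \<bar>N j\<bar> = max (al i) (bl i)" .
      have "(\<lambda>y. y $ i) ` e = closed_segment (a $ i) (b $ i)"
        unfolding ab(1) by (rule closed_segment_linear_image[symmetric]) (simp add: linear_iff)
      then show "(\<lambda>y. y $ i) ` e = {of_int (min (al i) (bl i))..of_int (min (al i) (bl i) + int (affine_length e) * \<bar>N j\<bar>)}"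
        unfolding m by (auto simp: closed_segment_eq_real_ivl al bl)
    qed
  qed
qed

text \<open>If the determinant \<open>D\<close> of the two normals vanished, the normals would be
  proportional and the lines translates of each other. If not, a quarter turn of \<open>N\<close>,
  scaled by \<open>1 / D\<close>, is the required vector.\<close>

lemma nonparallel_dual:
  assumes cop: "coprime (N 1) (N 2)" and M: "coprime (M 1) (M 2)"
    and e: "affine hull e = {y. int_vec N \<bullet> y = of_int c}"
    and e': "affine hull e' = {y. int_vec M \<bullet> y = of_int d}"
    and "\<not> parallel_sides e e'"
  shows "\<exists>v. int_vec N \<bullet> v = 0 \<and> int_vec M \<bullet> v = 1"
proof -
  define D where "D = real_of_int (N 1) * of_int (M 2) - of_int (N 2) * of_int (M 1)"
  have "D \<noteq> 0"
  proof
    assume "D = 0"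
    obtain r s where rs: "r * N 1 + s * N 2 = 1"
      using bezout_int[of "N 1" "N 2"] cop by (auto simp: coprime_iff_gcd_eq_1)
    then have rs': "of_int r * of_int (N 1) + of_int s * of_int (N 2) = (1::real)"
      by (metis of_int_1 of_int_add of_int_mult)
    define \<kappa> where "\<kappa> = of_int r * of_int (M 1) + of_int s * real_of_int (M 2)"
    have "of_int (M 1) = \<kappa> * of_int (N 1)" "of_int (M 2) = \<kappa> * of_int (N 2)"
      using \<open>D = 0\<close> rs' unfolding D_def \<kappa>_def by algebra+
    then have MN: "int_vec M = \<kappa> *\<^sub>R int_vec N" by (auto simp: vec_eq_iff forall_2)
    have "int_vec M \<noteq> 0" "int_vec N \<noteq> 0" using M cop by (auto simp: vec_eq_iff forall_2)
    then have "\<kappa> \<noteq> 0" by (auto simp: MN)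
    \<comment> \<open>The multiple of \<open>N\<close> that carries the line at level
      \<open>c\<close> to the one at level \<open>d / \<kappa>\<close>, which is the line of
      \<open>e'\<close> rewritten in terms of \<open>N\<close>.\<close>
    define w where "w = ((of_int d / \<kappa> - of_int c) / (int_vec N \<bullet> int_vec N)) *\<^sub>R int_vec N"
    have Nw: "int_vec N \<bullet> w = of_int d / \<kappa> - of_int c"
      using \<open>int_vec N \<noteq> 0\<close> by (simp add: w_def)
    have "affine hull e' = (\<lambda>x. w + x) ` (affine hull e)"
    proof (intro equalityI subsetI)
      fix y assume "y \<in> affine hull e'"
      then have "y - w \<in> affine hull e"
        using \<open>\<kappa> \<noteq> 0\<close> by (simp add: e e' MN inner_diff_right Nw field_simps)
      then show "y \<in> (\<lambda>x. w + x) ` (affine hull e)" by (auto simp: image_iff intro!: bexI[of _ "y - w"])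
    next
      fix y assume "y \<in> (\<lambda>x. w + x) ` (affine hull e)"
      then show "y \<in> affine hull e'"
        using \<open>\<kappa> \<noteq> 0\<close> by (auto simp: e e' MN inner_add_right Nw field_simps)
    qed
    then show False using assms(5) by (auto simp: parallel_sides_def affine_parallel_def)
  qed
  define v :: "real ^ 2" where "v = (\<chi> k. if k = 1 then - of_int (N 2) / D else of_int (N 1) / D)"
  have "int_vec N \<bullet> v = 0"
    by (simp add: inner_2[of 1 2] v_def)
  moreover have "int_vec M \<bullet> v = (of_int (N 1) * of_int (M 2) - of_int (N 2) * of_int (M 1)) / D"
    by (simp add: inner_2[of 1 2] v_def diff_divide_distrib mult.commute)
  then have "int_vec M \<bullet> v = 1"
    using \<open>D \<noteq> 0\<close> by (simp flip: D_def)
  ultimately show ?thesis by auto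
qed

section \<open>Slices of the polygon parallel to a coordinate axis\<close>

definition point :: "2 \<Rightarrow> real \<Rightarrow> real \<Rightarrow> real ^ 2" where
  "point i s t = (\<chi> k. if k = i then s else t)"

lemma point_nth [simp]: "point i s t $ i = s" "i \<noteq> j \<Longrightarrow> point i s t $ j = t"
  by (auto simp: point_def)

lemma vec_eq_2_iff: "i \<noteq> j \<Longrightarrow> x = y \<longleftrightarrow> x $ i = y $ i \<and> x $ j = (y $ j :: real)" for i j :: 2
  using exhaust_2[of i] exhaust_2[of j] by (auto simp: vec_eq_iff forall_2)

text \<open>The identity is exact even if \<open>lo + u\<close> or \<open>hi + u\<close> is an
  integer, because \<open>sawtooth\<close> takes the value -1/2 at integers: closed intervals
  contain both ends.\<close>

lemma card_int_Icc_shift: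
  assumes "lo \<le> hi"
  shows "{z::int. real_of_int z - u \<in> {lo..hi}} = {\<lceil>lo + u\<rceil>..\<lfloor>hi + u\<rfloor>}"
    and "real (card {z::int. real_of_int z - u \<in> {lo..hi}}) = hi - lo - sawtooth (hi + u) - sawtooth (- (lo + u))"
proof -
  show eq: "{z::int. real_of_int z - u \<in> {lo..hi}} = {\<lceil>lo + u\<rceil>..\<lfloor>hi + u\<rfloor>}"
    by (auto simp: ceiling_le_iff le_floor_iff algebra_simps)
  \<comment> \<open>Guards against truncation in the cardinality: an interval without integers gives
    exactly 0 and not a negative number.\<close>
  have "\<lfloor>hi + u\<rfloor> - \<lceil>lo + u\<rceil> + 1 \<ge> 0" using assms by linarith
  then show "real (card {z::int. real_of_int z - u \<in> {lo..hi}}) = hi - lo - sawtooth (hi + u) - sawtooth (- (lo + u))"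
    unfolding eq by (simp add: sawtooth_def frac_def ceiling_def)
qed

text \<open>Fixes one choice of primitive outward normals \<open>N\<close> and levels
  \<open>c\<close>, with the properties from \<open>edge_normal\<close> that the counting
  uses.\<close>

locale polygon_normals =
  fixes P :: "(real ^ 2) set" and N :: "(real ^ 2) set \<Rightarrow> 2 \<Rightarrow> int" and c :: "(real ^ 2) set \<Rightarrow> int"
  assumes polygon: "convex_integer_polygon P"
    and coprime_normal: "e \<in> sides P \<Longrightarrow> coprime (N e 1) (N e 2)"
    and normal_le: "e \<in> sides P \<Longrightarrow> y \<in> P \<Longrightarrow> int_vec (N e) \<bullet> y \<le> of_int (c e)"
    and side_eq: "e \<in> sides P \<Longrightarrow> e = {y \<in> P. int_vec (N e) \<bullet> y = of_int (c e)}"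
    and side_proj: "e \<in> sides P \<Longrightarrow> i \<noteq> j \<Longrightarrow>
      \<exists>A::int. (\<lambda>y. y $ i) ` e = {of_int A..of_int (A + int (affine_length e) * \<bar>N e j\<bar>)}"
begin

lemma poly: "polytope P" and dim: "aff_dim P = 2"
  and vertex_Ints: "v extreme_point_of P \<Longrightarrow> v $ i \<in> \<int>"
  using polygon by (auto simp: convex_integer_polygon_def int_lattice_def)

lemma finite_sides: "finite (sides P)"
  by (rule finite_subset[OF _ finite_polytope_faces[OF poly]]) (auto simp: sides_def edge_of_def)

lemma coprime_normal': "e \<in> sides P \<Longrightarrow> i \<noteq> j \<Longrightarrow> coprime (N e i) (N e j)"
  using coprime_normal[of e] exhaust_2[of i] exhaust_2[of j] by (auto simp: coprime_commute)

lemma side_subset: "e \<in> sides P \<Longrightarrow> e \<subseteq> P"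
  using side_eq by blast

text \<open>Two distinct sides share at most a vertex, and vertices have integer
  coordinates.\<close>

lemma side_unique:
  assumes e: "e \<in> sides P" "y \<in> e" and e': "e' \<in> sides P" "y \<in> e'" and y: "y $ i \<notin> \<int>"
  shows "e = e'"
proof (rule ccontr)
  assume "e \<noteq> e'"
  have f: "e face_of P" "e' face_of P" "aff_dim e = 1" "aff_dim e' = 1"
    using e e' by (auto simp: sides_def edge_of_def)
  have "e \<inter> e' \<noteq> e"
  proof
    assume "e \<inter> e' = e"
    then have "e face_of e'" using f e' by (metis face_of_subset face_of_imp_subset inf_le2)
    then have "aff_dim e < aff_dim e'"
      using \<open>e \<noteq> e'\<close> f face_of_imp_convex by (metis face_of_aff_dim_lt)
    then show False using f by simp
  qed
  moreover have ef: "e \<inter> e' face_of P" using f face_of_Int by blast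
  then have "e \<inter> e' face_of e" using f by (metis face_of_subset face_of_imp_subset inf_le1)
  ultimately have "aff_dim (e \<inter> e') < 1"
    using f face_of_imp_convex by (metis face_of_aff_dim_lt)
  moreover have "\<not> aff_dim (e \<inter> e') < 0" using e e' by (simp add: aff_dim_negative_iff) blast
  ultimately have "aff_dim (e \<inter> e') = 0" by linarith
  then obtain x where "e \<inter> e' = {x}" using aff_dim_eq_0 by metis
  moreover have "y \<in> e \<inter> e'" using e e' by blast
  ultimately have "e \<inter> e' = {y}" by simp
  then have "y extreme_point_of P" using ef by (simp add: face_of_singleton)
  then show False using vertex_Ints y by blast
qed

text \<open>A primitive normal with \<open>N e j = 0\<close> has other entry 1 or -1, which would
  put the side on a line where coordinate \<open>i\<close> is an integer.\<close>

lemma normal_nonzero: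
  assumes e: "e \<in> sides P" "y \<in> e" and y: "y $ i \<notin> \<int>" and ij: "i \<noteq> j"
  shows "N e j \<noteq> 0"
proof
  assume 0: "N e j = 0"
  then have "\<bar>N e i\<bar> = 1" using coprime_normal'[OF e(1) ij] by simp
  then have "N e i = 1 \<or> N e i = - 1" by linarith
  moreover have "of_int (N e i) * y $ i = of_int (c e)"
  proof -
    have "int_vec (N e) \<bullet> y = of_int (c e)" using side_eq e by blast
    then show ?thesis using 0 by (simp add: inner_2[OF ij])
  qed
  ultimately have "y $ i = of_int (c e) \<or> y $ i = of_int (- c e)" by auto
  then show False using y by (metis Ints_of_int)
qed

text \<open>A point that can be left in direction \<open>d\<close> by arbitrarily small steps is not
  interior, and the frontier of a full-dimensional polytope is covered by its facets, which in
  dimension 2 are the sides.\<close>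

lemma frontier_side:
  assumes y: "y \<in> P" and d: "\<And>\<epsilon>. \<epsilon> > 0 \<Longrightarrow> y + \<epsilon> *\<^sub>R d \<notin> P"
  shows "\<exists>e\<in>sides P. y \<in> e"
proof -
  have "y \<notin> interior P"
  proof
    assume "y \<in> interior P"
    then obtain r where r: "r > 0" "ball y r \<subseteq> P" by (auto simp: mem_interior)
    define \<epsilon> where "\<epsilon> = r / (2 * (norm d + 1))"
    have "\<epsilon> > 0" using r by (simp add: \<epsilon>_def add_nonneg_pos)
    have "\<epsilon> * norm d \<le> \<epsilon> * (norm d + 1)" using \<open>\<epsilon> > 0\<close> by simp
    also have "\<dots> = r / 2"
    proof -
      have "norm d + 1 \<noteq> 0" using norm_ge_zero[of d] by linarith
      then show ?thesis by (simp add: \<epsilon>_def divide_simps)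
    qed
    also have "\<dots> < r" using r by simp
    finally have "y + \<epsilon> *\<^sub>R d \<in> ball y r" using \<open>\<epsilon> > 0\<close> by (simp add: dist_norm)
    then show False using r d[OF \<open>\<epsilon> > 0\<close>] by blast
  qed
  then have "y \<in> frontier P" using y closure_subset by (auto simp: frontier_def)
  moreover have "affine hull P = UNIV" using dim by (simp flip: aff_dim_eq_full)
  ultimately have "y \<in> rel_frontier P" by (simp add: rel_frontier_frontier)
  then obtain e where "e facet_of P" "y \<in> e"
    using rel_frontier_of_polyhedron[OF polytope_imp_polyhedron[OF poly]] by blast
  then show ?thesis using dim by (auto simp: sides_def edge_of_def facet_of_def)
qed

text \<open>If the side \<open>e\<close> through \<open>y\<close> had its normal on the wrong side, the slice would degenerate to
  a point; a segment in \<open>P\<close> from a point off \<open>e\<close> to an end of \<open>e\<close> beyond \<open>y\<close> excludes this.\<close>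

lemma column_end_side:
  fixes \<tau> :: real
  assumes ij: "i \<noteq> j" and y: "y \<in> P" "y $ i \<notin> \<int>" and \<tau>: "\<tau> \<noteq> 0"
    and max: "\<And>y'. y' \<in> P \<Longrightarrow> y' $ i = y $ i \<Longrightarrow> \<tau> * y' $ j \<le> \<tau> * y $ j"
  shows "\<exists>e\<in>sides P. y \<in> e \<and> \<tau> * of_int (N e j) > 0"
proof -
  have "\<exists>e\<in>sides P. y \<in> e"
  proof (rule frontier_side[OF y(1)])
    fix \<epsilon> :: real assume "\<epsilon> > 0"
    \<comment> \<open>The step along \<open>axis j \<tau>\<close> raises
      \<open>\<tau> * y $ j\<close> by this positive amount, beyond the maximum over the
      slice.\<close>
    then have "\<epsilon> * (\<tau> * \<tau>) > 0" using \<tau> by (metis mult_pos_pos not_real_square_gt_zero)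
    then show "y + \<epsilon> *\<^sub>R axis j \<tau> \<notin> P"
      using max[of "y + \<epsilon> *\<^sub>R axis j \<tau>"] ij by (auto simp: axis_def algebra_simps)
  qed
  then obtain e where e: "e \<in> sides P" "y \<in> e" by blast
  have Ny: "int_vec (N e) \<bullet> y = of_int (c e)" using e side_eq by blast
  have "\<tau> * of_int (N e j) > 0"
  proof (rule ccontr)
    assume "\<not> \<tau> * of_int (N e j) > 0"
    then have neg: "\<tau> * of_int (N e j) < 0"
      using normal_nonzero[OF e y(2) ij] \<tau> by (metis linorder_neqE_linordered_idom mult_eq_0_iff of_int_eq_0_iff)
    obtain w where w: "w \<in> P" "int_vec (N e) \<bullet> w < of_int (c e)"
    proof -
      have "e \<noteq> P" using e dim by (auto simp: sides_def edge_of_def)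
      then show ?thesis using that side_eq[OF e(1)] normal_le[OF e(1)] by force
    qed
    obtain A B :: int where AB: "(\<lambda>y. y $ i) ` e = {of_int A..of_int B}"
      using side_proj[OF e(1) ij] by blast
    have yi: "y $ i \<in> {of_int A..of_int B}" using e(2) AB by blast
    moreover have "y $ i \<noteq> of_int A" "y $ i \<noteq> of_int B" using y(2) by auto
    ultimately have "of_int A < y $ i" "y $ i < of_int B" by auto
    moreover have "real_of_int A \<in> (\<lambda>y. y $ i) ` e" "real_of_int B \<in> (\<lambda>y. y $ i) ` e"
      using yi unfolding AB by auto
    ultimately obtain z where z: "z \<in> e" "w $ i \<le> y $ i \<and> y $ i < z $ i \<or> z $ i < y $ i \<and> y $ i \<le> w $ i"
      by (cases "w $ i \<le> y $ i") force+
    have zP: "z \<in> P" "int_vec (N e) \<bullet> z = of_int (c e)" using z side_eq[OF e(1)] by blast+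
    \<comment> \<open>The parameter at which the segment from \<open>w\<close> to \<open>z\<close>
      crosses the slice through \<open>y\<close>. Since \<open>t < 1\<close>, the point
      \<open>w\<close> keeps positive weight and the crossing point stays strictly off the line of
      \<open>e\<close>.\<close>
    define t where "t = (y $ i - w $ i) / (z $ i - w $ i)"
    have t: "0 \<le> t" "t < 1" using z(2) by (auto simp: t_def divide_simps)
    define y' where "y' = (1 - t) *\<^sub>R w + t *\<^sub>R z"
    have "y' \<in> P"
      unfolding y'_def using t w zP polytope_imp_convex[OF poly] by (intro convexD) auto
    have "y' $ i = w $ i + t * (z $ i - w $ i)" by (simp add: y'_def algebra_simps)
    also have "\<dots> = y $ i" using z(2) by (auto simp: t_def)
    finally have y'i: "y' $ i = y $ i" .
    have "(1 - t) * (int_vec (N e) \<bullet> w) < (1 - t) * of_int (c e)" using w t by simp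
    then have "int_vec (N e) \<bullet> y' < of_int (c e)"
      by (simp add: y'_def inner_add_right zP algebra_simps)
    then have "of_int (N e j) * (y' $ j - y $ j) < 0"
      using Ny y'i by (simp add: inner_2[OF ij] algebra_simps)
    moreover have "\<tau> * \<tau> > 0" using \<tau> by (metis not_real_square_gt_zero)
    ultimately have *: "(\<tau> * \<tau>) * (of_int (N e j) * (y' $ j - y $ j)) < 0"
      using mult_pos_neg by blast
    have "\<tau> * (y' $ j - y $ j) \<le> 0"
      using max[OF \<open>y' \<in> P\<close> y'i] by (simp add: algebra_simps)
    then have "0 \<le> (\<tau> * of_int (N e j)) * (\<tau> * (y' $ j - y $ j))"
      using neg by (intro mult_nonpos_nonpos) auto
    also have "\<dots> = (\<tau> * \<tau>) * (of_int (N e j) * (y' $ j - y $ j))"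
      by (simp only: mult_ac)
    finally show False using * by linarith
  qed
  then show ?thesis using e by blast
qed

text \<open>For a nonempty slice, \<open>L\<close> is its length, which does not depend on
  \<open>u\<close>. Exactly two sides enter the sum, one at each end, and dividing by
  \<open>\<bar>N e j\<bar>\<close> turns their arguments into \<open>hi + u\<close> and
  \<open>- (lo + u)\<close>.\<close>

lemma column_count:
  assumes ij: "i \<noteq> j" and s: "s \<notin> \<int>"
  shows "\<exists>L. \<forall>u. finite {z::int. point i s (of_int z - u) \<in> P} \<and>
    real (card {z::int. point i s (of_int z - u) \<in> P}) =
      L - (\<Sum>e\<in>{e\<in>sides P. N e j \<noteq> 0 \<and> s \<in> (\<lambda>y. y $ i) ` e}.
            sawtooth ((of_int (c e) - of_int (N e i) * s + of_int (N e j) * u) / \<bar>of_int (N e j)\<bar>))"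
    (is "\<exists>L. \<forall>u. finite (?C u) \<and> real (card (?C u)) = L - sum (?f u) ?E")
proof -
  define T where "T = (\<lambda>y. y $ j) ` (P \<inter> {y. y $ i = s})"
  have pt: "y = point i s (y $ j)" if "y $ i = s" for y
    using that ij by (simp add: vec_eq_2_iff[OF ij])
  have T: "t \<in> T \<longleftrightarrow> point i s t \<in> P" for t
    unfolding T_def using ij pt by (force simp: image_iff)
  have C: "?C u = {z. of_int z - u \<in> T}" for u by (simp add: T)
  have E: "\<exists>y\<in>P. y $ i = s \<and> y \<in> e" if "e \<in> ?E" for e using that side_subset by blast
  show ?thesis
  proof (cases "T = {}")
    case True
    then have "?E = {}" using E unfolding T_def by blast
    then show ?thesis using True unfolding C by (intro exI[of _ 0]) (simp only:, simp)
  next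
    case False
    have hyp: "{y :: real ^ 2. y $ i = s} = {y. axis i 1 \<bullet> y = s}" by (simp add: inner_axis')
    have "compact (P \<inter> {y. y $ i = s})"
      unfolding hyp using polytope_imp_compact[OF poly] closed_hyperplane by (rule compact_Int_closed)
    then have "compact T" unfolding T_def
      by (intro compact_continuous_image continuous_intros)
    have "convex (P \<inter> {y. y $ i = s})"
      unfolding hyp using polytope_imp_convex[OF poly] convex_hyperplane by (rule convex_Int)
    then have "convex T" unfolding T_def
      by (rule convex_linear_image[rotated]) (simp add: linear_iff)
    then have "connected T" by (rule convex_connected)
    with \<open>compact T\<close> obtain lo hi where lohi: "T = {lo..hi}"
      by (metis connected_compact_interval_1)
    with False have le: "lo \<le> hi" by auto
    have col: "lo \<le> y $ j" "y $ j \<le> hi" if "y \<in> P" "y $ i = s" for y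
      using that lohi by (auto simp: T_def)
    obtain U where U: "U \<in> sides P" "point i s hi \<in> U" "N U j > 0"
      using column_end_side[OF ij, of "point i s hi" 1] s ij col T[of hi] le lohi by force
    obtain D where D: "D \<in> sides P" "point i s lo \<in> D" "N D j < 0"
      using column_end_side[OF ij, of "point i s lo" "-1"] s ij col T[of lo] le lohi by force
    \<comment> \<open>All points of the slice satisfy the inequality of \<open>e\<close>, so by the
      sign of \<open>N e j\<close> the side can touch the slice only at its top or its bottom;
      \<open>side_unique\<close> then identifies it.\<close>
    have "e = U \<or> e = D" if e: "e \<in> ?E" for e
    proof -
      obtain y where y: "y \<in> P" "y $ i = s" "y \<in> e" using E[OF e] by blast
      have ey: "int_vec (N e) \<bullet> y = of_int (c e)" using y e side_eq by blast
      have t: "of_int (N e j) * t \<le> of_int (N e j) * y $ j" if "t \<in> T" for t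
        using normal_le[of e "point i s t"] that e ey y ij unfolding T by (simp add: inner_2[OF ij])
      show ?thesis
      proof (cases "N e j > 0")
        case True
        then have "hi \<le> y $ j" using t[of hi] lohi le by simp
        then have "y = point i s hi" using col[OF y(1,2)] pt[OF y(2)] by simp
        then show ?thesis using side_unique[of e y U i] e U s y by auto
      next
        case False
        then have "N e j < 0" using e by auto
        then have "y $ j \<le> lo" using t[of lo] lohi le by simp
        then have "y = point i s lo" using col[OF y(1,2)] pt[OF y(2)] by simp
        then show ?thesis using side_unique[of e y D i] e D s y by auto
      qed
    qed
    moreover have "s \<in> (\<lambda>y. y $ i) ` U" "s \<in> (\<lambda>y. y $ i) ` D"
      using U(2) D(2) by (force simp: image_iff)+
    ultimately have EUD: "?E = {U, D}" using U D by auto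
    have "U \<noteq> D" using U D by auto
    have Ueq: "of_int (c U) = of_int (N U i) * s + of_int (N U j) * hi"
    proof -
      have "int_vec (N U) \<bullet> point i s hi = of_int (c U)" using U(1,2) side_eq by blast
      then show ?thesis using ij by (simp add: inner_2[OF ij])
    qed
    have Deq: "of_int (c D) = of_int (N D i) * s + of_int (N D j) * lo"
    proof -
      have "int_vec (N D) \<bullet> point i s lo = of_int (c D)" using D(1,2) side_eq by blast
      then show ?thesis using ij by (simp add: inner_2[OF ij])
    qed
    have fU: "?f u U = sawtooth (hi + u)" for u
    proof -
      have "(of_int (c U) - of_int (N U i) * s + of_int (N U j) * u) / \<bar>of_int (N U j)\<bar> = hi + u"
        using U(3) by (simp add: Ueq field_simps)
      then show ?thesis by (rule arg_cong)
    qed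
    have fD: "?f u D = sawtooth (- (lo + u))" for u
    proof -
      have "(of_int (c D) - of_int (N D i) * s + of_int (N D j) * u) / \<bar>of_int (N D j)\<bar> = - (lo + u)"
        using D(3) by (simp add: Deq field_simps)
      then show ?thesis by (rule arg_cong)
    qed
    have "sum (?f u) ?E = sawtooth (hi + u) + sawtooth (- (lo + u))" for u
    proof -
      have pair: "sum g {U, D} = g U + g D" for g :: "(real ^ 2) set \<Rightarrow> real"
        using \<open>U \<noteq> D\<close> by simp
      show ?thesis unfolding EUD pair fU fD by (rule refl)
    qed
    then show ?thesis
      unfolding C lohi using card_int_Icc_shift[OF le] by (intro exI[of _ "hi - lo"]) simp
  qed
qed

end

subsection \<open>Counting lattice points\<close>

lemma translate_count_conv:
  assumes ij: "i \<noteq> j"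
  shows "translate_count P x = card {(k::int, z::int). point i (of_int k - x $ i) (of_int z - x $ j) \<in> P}"
proof -
  let ?p = "\<lambda>(k::int, z::int). point i (of_int k) (of_int z)"
  let ?S = "{(k::int, z::int). point i (of_int k - x $ i) (of_int z - x $ j) \<in> P}"
  have p: "point i (a - x $ i) (b - x $ j) = point i a b - x" for a b
    using ij by (simp add: vec_eq_2_iff[OF ij])
  have inj: "inj_on ?p ?S"
    using ij by (auto simp: inj_on_def vec_eq_2_iff[OF ij])
  have "(\<lambda>c. c + x) ` P \<inter> int_lattice = ?p ` ?S"
  proof (intro equalityI subsetI)
    fix y assume y: "y \<in> (\<lambda>c. c + x) ` P \<inter> int_lattice"
    then obtain q where q: "q \<in> P" "y = q + x" by blast
    obtain M where M: "y = int_vec M" using y by (auto simp: int_lattice_conv)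
    have "y = point i (of_int (M i)) (of_int (M j))" using ij by (simp add: M vec_eq_2_iff[OF ij])
    moreover have "y - x \<in> P" using q by simp
    ultimately show "y \<in> ?p ` ?S" by (intro image_eqI[of _ _ "(M i, M j)"]) (auto simp: p algebra_simps)
  next
    fix y assume "y \<in> ?p ` ?S"
    then obtain k z :: int where y: "y = point i (of_int k) (of_int z)" "y - x \<in> P" by (auto simp: p)
    then have "y $ k' \<in> \<int>" for k' by (auto simp: point_def)
    then show "y \<in> (\<lambda>c. c + x) ` P \<inter> int_lattice"
      using y(2) by (auto simp: int_lattice_def image_iff intro!: bexI[of _ "y - x"])
  qed
  then show ?thesis by (simp add: translate_count_def card_image[OF inj])
qed

text \<open>For each fixed lattice point, lying in the translate is a closed condition on
  \<open>x\<close>; the count is the cardinality of a countable family of such conditions.\<close>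

lemma measurable_translate_count [measurable]:
  assumes "closed P"
  shows "translate_count P \<in> measurable borel (count_space UNIV)"
proof -
  \<comment> \<open>Lattice points are coded by natural numbers to fit
    \<open>measurable_card\<close>; the range condition keeps only genuine codes.\<close>
  define S :: "real ^ 2 \<Rightarrow> nat set"
    where "S x = {n. n \<in> range (to_nat :: int \<times> int \<Rightarrow> nat) \<and>
      point 1 (of_int (fst (from_nat n :: int \<times> int)) - x $ 1) (of_int (snd (from_nat n :: int \<times> int)) - x $ 2) \<in> P}" for x
  have "translate_count P x = card (S x)" for x
  proof -
    have "S x = to_nat ` {(k::int, z::int). point 1 (of_int k - x $ 1) (of_int z - x $ 2) \<in> P}"
      unfolding S_def by force
    then show ?thesis
      by (simp add: translate_count_conv[of 1 2] card_image inj_on_def)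
  qed
  then have eq: "translate_count P = (\<lambda>x. card (S x))" by auto
  show ?thesis unfolding eq
  proof (rule measurable_card)
    fix n
    define a b where "a = real_of_int (fst (from_nat n :: int \<times> int))" and "b = real_of_int (snd (from_nat n :: int \<times> int))"
    have "point 1 (a - x $ 1) (b - x $ 2) = point 1 a b - x" for x
      by (simp add: vec_eq_2_iff[of 1 2])
    then have "{x \<in> space borel. n \<in> S x} = (if n \<in> range (to_nat :: int \<times> int \<Rightarrow> nat) then {x. point 1 a b - x \<in> P} else {})"
      by (simp add: S_def a_def b_def)
    moreover have "closed ((\<lambda>x. point 1 a b - x) -` P)"
      using assms by (intro closed_vimage continuous_intros)
    ultimately show "{x \<in> space borel. n \<in> S x} \<in> sets borel"
      by (auto simp: vimage_def)
  qed
qed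

context polygon_normals
begin

text \<open>Adds up \<open>column_count\<close> over all columns and exchanges the sums. A side with
  \<open>N e j \<noteq> 0\<close> meets a run of consecutive columns consisting of whole periods, so
  its terms collapse to one sawtooth. Non-integrality of \<open>x $ i\<close> keeps the columns off
  the vertices.\<close>

lemma count_plus_sawtooth_slice:
  assumes ij: "i \<noteq> j"
  shows "\<exists>H. \<forall>x. x $ i \<notin> \<int> \<longrightarrow>
    real (translate_count P x) + (\<Sum>e\<in>sides P. affine_length e * sawtooth (int_vec (N e) \<bullet> x)) = H (x $ i)"
proof -
  define W where "W s u = (\<Sum>e\<in>{e\<in>sides P. N e j \<noteq> 0 \<and> s \<in> (\<lambda>y. y $ i) ` e}.
      sawtooth ((of_int (c e) - of_int (N e i) * s + of_int (N e j) * u) / \<bar>of_int (N e j)\<bar>))" for s u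
  have "\<forall>s. \<exists>L. s \<notin> \<int> \<longrightarrow> (\<forall>u. finite {z::int. point i s (of_int z - u) \<in> P} \<and>
      real (card {z::int. point i s (of_int z - u) \<in> P}) = L - W s u)"
    using column_count[OF ij] unfolding W_def by blast
  then obtain L where L: "\<And>s u. s \<notin> \<int> \<Longrightarrow> finite {z::int. point i s (of_int z - u) \<in> P}"
    "\<And>s u. s \<notin> \<int> \<Longrightarrow> real (card {z::int. point i s (of_int z - u) \<in> P}) = L s - W s u"
    by metis
  obtain R where R: "\<bar>y $ i\<bar> \<le> R" if "y \<in> P" for y
    using polytope_imp_bounded[OF poly] component_le_norm_cart order_trans unfolding bounded_iff by metis
  \<comment> \<open>A finite range of columns that includes every column meeting the
    translate.\<close>
  define K where "K a = {k::int. \<bar>of_int k - a\<bar> \<le> R}" for a :: real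
  have finK: "finite (K a)" for a
  proof (rule finite_subset)
    show "K a \<subseteq> {\<lfloor>a - R\<rfloor>..\<lceil>a + R\<rceil>}" by (auto simp: K_def) linarith+
  qed simp
  define E where "E = {e\<in>sides P. N e j \<noteq> 0}"
  have finE: "finite E" using finite_sides by (simp add: E_def)
  \<comment> \<open>What does not cancel: slice lengths, and the sides with
    \<open>N e j = 0\<close>, whose sawtooth sees only coordinate \<open>i\<close>.\<close>
  define H where "H a = (\<Sum>k\<in>K a. L (of_int k - a))
      + (\<Sum>e\<in>sides P - E. affine_length e * sawtooth (of_int (N e i) * a))" for a
  have "real (translate_count P x) + (\<Sum>e\<in>sides P. affine_length e * sawtooth (int_vec (N e) \<bullet> x)) = H (x $ i)"
    if x: "x $ i \<notin> \<int>" for x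
  proof -
    define s where "s k = of_int k - x $ i" for k :: int
    have s: "s k \<notin> \<int>" for k
      using x Ints_diff[of "of_int k" "s k"] by (auto simp: s_def)
    let ?f = "\<lambda>k e. sawtooth ((of_int (c e) - of_int (N e i) * s k + of_int (N e j) * x $ j) / \<bar>of_int (N e j)\<bar>)"
    let ?Z = "\<lambda>k. {z::int. point i (s k) (of_int z - x $ j) \<in> P}"
    have "{(k::int, z::int). point i (of_int k - x $ i) (of_int z - x $ j) \<in> P} = Sigma (K (x $ i)) ?Z"
      using R by (fastforce simp: K_def s_def)
    then have "translate_count P x = card (Sigma (K (x $ i)) ?Z)"
      by (simp add: translate_count_conv[OF ij])
    also have "\<dots> = (\<Sum>k\<in>K (x $ i). card (?Z k))"
      using L(1)[OF s] finK by (intro card_SigmaI) auto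
    finally have "real (translate_count P x) = (\<Sum>k\<in>K (x $ i). real (card (?Z k)))" by simp
    also have "\<dots> = (\<Sum>k\<in>K (x $ i). L (s k)) - (\<Sum>k\<in>K (x $ i). \<Sum>e\<in>{e\<in>sides P. N e j \<noteq> 0 \<and> s k \<in> (\<lambda>y. y $ i) ` e}. ?f k e)"
      unfolding L(2)[OF s] sum_subtractf W_def ..
    also have "(\<Sum>k\<in>K (x $ i). \<Sum>e\<in>{e\<in>sides P. N e j \<noteq> 0 \<and> s k \<in> (\<lambda>y. y $ i) ` e}. ?f k e)
        = (\<Sum>k\<in>K (x $ i). \<Sum>e\<in>{e\<in>E. s k \<in> (\<lambda>y. y $ i) ` e}. ?f k e)"
      by (simp add: E_def conj_assoc)
    also have "\<dots> = (\<Sum>e\<in>E. \<Sum>k\<in>{k\<in>K (x $ i). s k \<in> (\<lambda>y. y $ i) ` e}. ?f k e)"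
      using finK finE by (rule sum.swap_restrict)
    also have "\<dots> = (\<Sum>e\<in>E. affine_length e * sawtooth (int_vec (N e) \<bullet> x))"
    proof (rule sum.cong)
      fix e assume "e \<in> E"
      then have e: "e \<in> sides P" "N e j \<noteq> 0" by (auto simp: E_def)
      define m where "m = nat \<bar>N e j\<bar>"
      have m: "m > 0" "int m = \<bar>N e j\<bar>" "real m = \<bar>of_int (N e j)\<bar>" using e by (auto simp: m_def)
      obtain A where A: "(\<lambda>y. y $ i) ` e = {of_int A..of_int (A + int (affine_length e) * \<bar>N e j\<bar>)}"
        using side_proj[OF e(1) ij] by blast
      \<comment> \<open>As \<open>x $ i\<close> is not an integer, \<open>s k\<close> lies in
        \<open>[A, B]\<close> exactly for \<open>\<lfloor>x $ i\<rfloor> + A + 1 \<le> k \<le>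
        \<lfloor>x $ i\<rfloor> + B\<close>. That is \<open>B - A\<close> columns, not
        \<open>B - A + 1\<close>.\<close>
      define a where "a = \<lfloor>x $ i\<rfloor> + A + 1"
      have "{k\<in>K (x $ i). s k \<in> (\<lambda>y. y $ i) ` e} = {k. s k \<in> (\<lambda>y. y $ i) ` e}"
        using R side_subset[OF e(1)] by (force simp: K_def s_def)
      also have "\<dots> = {a..<a + int (affine_length e * m)}"
      proof -
        have "of_int \<lfloor>x $ i\<rfloor> \<noteq> x $ i" using x by (metis Ints_of_int)
        then have fl: "of_int \<lfloor>x $ i\<rfloor> < x $ i" "x $ i < of_int \<lfloor>x $ i\<rfloor> + 1" by linarith+
        have "of_int A \<le> s k \<longleftrightarrow> a \<le> k" "s k \<le> of_int B \<longleftrightarrow> k \<le> \<lfloor>x $ i\<rfloor> + B" for k B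
          using fl unfolding s_def a_def by linarith+
        then have "{k. s k \<in> {of_int A..of_int B}} = {a..<a + (B - A)}" for B
          by (auto simp: a_def)
        moreover have "int (affine_length e * m) = int (affine_length e) * \<bar>N e j\<bar>"
          by (simp add: m)
        ultimately show ?thesis unfolding A by (simp only: add_diff_cancel_left')
      qed
      finally have ks: "{k\<in>K (x $ i). s k \<in> (\<lambda>y. y $ i) ` e} = {a..<a + int (affine_length e * m)}" .
      \<comment> \<open>Isolates the dependence on \<open>k\<close>, an integer progression with
        step \<open>- N e i\<close>, which is coprime to \<open>m\<close>; the integer
        \<open>c e\<close> later drops out by periodicity.\<close>
      have arg: "of_int (c e) - of_int (N e i) * s k + of_int (N e j) * x $ j
          = of_int (c e) + int_vec (N e) \<bullet> x + of_int (- N e i * k)" for k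
        by (simp add: s_def inner_2[OF ij] algebra_simps)
      have "(\<Sum>k\<in>{k\<in>K (x $ i). s k \<in> (\<lambda>y. y $ i) ` e}. ?f k e)
          = (\<Sum>k\<in>{a..<a + int (affine_length e * m)}. sawtooth ((of_int (c e) + int_vec (N e) \<bullet> x + of_int (- N e i * k)) / real m))"
        unfolding ks arg m(3) ..
      also have "\<dots> = affine_length e * sawtooth (of_int (c e) + int_vec (N e) \<bullet> x)"
        using m coprime_normal'[OF e(1) ij] by (intro sum_sawtooth_periods) auto
      also have "sawtooth (of_int (c e) + int_vec (N e) \<bullet> x) = sawtooth (int_vec (N e) \<bullet> x)"
        by (subst add.commute) simp
      finally show "(\<Sum>k\<in>{k\<in>K (x $ i). s k \<in> (\<lambda>y. y $ i) ` e}. ?f k e) = affine_length e * sawtooth (int_vec (N e) \<bullet> x)" .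
    qed simp
    also have "(\<Sum>k\<in>K (x $ i). L (s k)) - (\<Sum>e\<in>E. affine_length e * sawtooth (int_vec (N e) \<bullet> x))
      + (\<Sum>e\<in>sides P. affine_length e * sawtooth (int_vec (N e) \<bullet> x)) = H (x $ i)"
    proof -
      have "E \<subseteq> sides P" by (auto simp: E_def)
      then have "(\<Sum>e\<in>sides P. affine_length e * sawtooth (int_vec (N e) \<bullet> x))
        = (\<Sum>e\<in>sides P - E. affine_length e * sawtooth (int_vec (N e) \<bullet> x)) + (\<Sum>e\<in>E. affine_length e * sawtooth (int_vec (N e) \<bullet> x))"
        using finite_sides by (intro sum.subset_diff)
      moreover have "(\<Sum>e\<in>sides P - E. affine_length e * sawtooth (int_vec (N e) \<bullet> x))
        = (\<Sum>e\<in>sides P - E. affine_length e * sawtooth (of_int (N e i) * x $ i))"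
        by (rule sum.cong) (auto simp: E_def inner_2[OF ij])
      ultimately show ?thesis by (simp add: H_def s_def)
    qed
    finally show ?thesis by simp
  qed
  then show ?thesis by blast
qed

text \<open>A function of the first coordinate alone and of the second alone is constant on a
  product set. Any two points are compared through points with second coordinate 1/2, chosen as a
  non-integer.\<close>

lemma count_plus_sawtooth_const:
  "\<exists>C. \<forall>x. x $ 1 \<notin> \<int> \<and> x $ 2 \<notin> \<int> \<longrightarrow>
    real (translate_count P x) + (\<Sum>e\<in>sides P. affine_length e * sawtooth (int_vec (N e) \<bullet> x)) = C"
proof -
  let ?h = "\<lambda>x. real (translate_count P x) + (\<Sum>e\<in>sides P. affine_length e * sawtooth (int_vec (N e) \<bullet> x))"
  obtain F G where F: "\<And>x. x $ 1 \<notin> \<int> \<Longrightarrow> ?h x = F (x $ 1)" and G: "\<And>x. x $ 2 \<notin> \<int> \<Longrightarrow> ?h x = G (x $ 2)"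
    using count_plus_sawtooth_slice[of 1 2] count_plus_sawtooth_slice[of 2 1] by auto
  have half: "1/2 \<notin> (\<int> :: real set)"
  proof
    assume "1/2 \<in> (\<int> :: real set)"
    then obtain k :: int where "1/2 = real_of_int k" by (rule Ints_cases)
    then have "2 * k = 1" by linarith
    then show False by presburger
  qed
  have "?h x = G (1/2)" if x: "x $ 1 \<notin> \<int>" "x $ 2 \<notin> \<int>" for x
  proof -
    have "?h x = F (x $ 1)" using F x by blast
    also have "\<dots> = ?h (point 1 (x $ 1) (1/2))" using F[of "point 1 (x $ 1) (1/2)"] x by simp
    also have "\<dots> = G (1/2)" using G[of "point 1 (x $ 1) (1/2)"] half by simp
    finally show ?thesis .
  qed
  then show ?thesis by blast
qed

end

text \<open>\<open>Q\<close> bundles the conclusions of \<open>edge_normal\<close> so that normals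
  and levels can be chosen for all sides at once. The equation for the affine hull is exported
  separately; it is what relates normals to parallelism.\<close>

lemma polygon_normals_exist:
  assumes P: "convex_integer_polygon P"
  shows "\<exists>N c. polygon_normals P N c \<and>
    (\<forall>e\<in>sides P. affine hull e = {y. int_vec (N e) \<bullet> y = of_int (c e)})"
proof -
  define Q where "Q e N c \<longleftrightarrow> coprime (N 1) (N 2) \<and> (\<forall>y\<in>P. int_vec N \<bullet> y \<le> of_int c) \<and>
      e = {y \<in> P. int_vec N \<bullet> y = of_int c} \<and> affine hull e = {y. int_vec N \<bullet> y = of_int c} \<and>
      (\<forall>i j. i \<noteq> j \<longrightarrow> (\<exists>A::int. (\<lambda>y. y $ i) ` e = {of_int A..of_int (A + int (affine_length e) * \<bar>N j\<bar>)}))"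
    for e :: "(real ^ 2) set" and N :: "2 \<Rightarrow> int" and c :: int
  have "\<exists>N c. Q e N c" if "e \<in> sides P" for e
  proof -
    have "e edge_of P" using that by (simp add: sides_def)
    show ?thesis
    proof (rule edge_normal[OF P \<open>e edge_of P\<close>])
      fix N :: "2 \<Rightarrow> int" and c :: int
      assume *: "coprime (N 1) (N 2)"
        "\<And>y. y \<in> P \<Longrightarrow> int_vec N \<bullet> y \<le> of_int c"
        "e = {y \<in> P. int_vec N \<bullet> y = of_int c}"
        "affine hull e = {y. int_vec N \<bullet> y = of_int c}"
        "\<And>i j. i \<noteq> j \<Longrightarrow> \<exists>A::int. (\<lambda>y. y $ i) ` e = {of_int A..of_int (A + int (affine_length e) * \<bar>N j\<bar>)}"
      have "Q e N c"
        unfolding Q_def by (intro conjI allI impI ballI) (fact *)+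
      then show ?thesis by blast
    qed
  qed
  then have "\<forall>e\<in>sides P. \<exists>N. \<exists>c. Q e N c" by blast
  from bchoice[OF this] obtain N where "\<forall>e\<in>sides P. \<exists>c. Q e (N e) c" by blast
  from bchoice[OF this] obtain c where Q: "\<And>e. e \<in> sides P \<Longrightarrow> Q e (N e) (c e)" by blast
  note q1 = Q[unfolded Q_def, THEN conjunct1] and q' = Q[unfolded Q_def, THEN conjunct2]
  note q2 = q'[THEN conjunct1, rule_format] and q'' = q'[THEN conjunct2]
  note q3 = q''[THEN conjunct1] and q4 = q''[THEN conjunct2, THEN conjunct1]
    and q5 = q''[THEN conjunct2, THEN conjunct2, rule_format]
  show ?thesis
  proof (intro exI conjI ballI)
    show "polygon_normals P N c"
      by (rule polygon_normals.intro[OF P q1 q2 q3 q5])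
  qed (rule q4)
qed

section \<open>From means over the unit square to the random translate\<close>

lemma expectation_unit_mean:
  fixes h :: "real ^ 2 \<Rightarrow> real"
  assumes X: "X \<in> borel_measurable M" "distr M borel X = uniform_measure lborel (cbox 0 1)"
    and h: "h \<in> borel_measurable borel"
  shows "(\<integral>\<omega>. h (X \<omega>) \<partial>M) = unit_mean h"
proof -
  \<comment> \<open>The vector \<open>1\<close> bounding the square in the law of \<open>X\<close>
    and the sum of basis vectors \<open>One\<close> in \<open>unit_mean\<close> are the same
    all-ones vector.\<close>
  have "(One :: real ^ 2) \<bullet> axis i 1 = 1" for i
    by (rule inner_sum_Basis) (auto simp: Basis_vec_def)
  then have "(One :: real ^ 2) $ i = 1" for i
    by (simp only: cart_eq_inner_axis)
  then have One: "(1 :: real ^ 2) = One"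
    by (simp only: vec_eq_iff one_index) simp
  have "(\<integral>\<omega>. h (X \<omega>) \<partial>M) = (\<integral>x. h x \<partial>uniform_measure lborel (cbox 0 1))"
    using integral_distr[OF X(1) h] X(2) by simp
  also have "\<dots> = unit_mean h"
  proof -
    have "uniform_measure lborel (cbox 0 (One :: real ^ 2)) = density lborel (\<lambda>x. ennreal (indicator (cbox 0 One) x))"
      unfolding uniform_measure_def by (rule density_cong) (auto simp: emeasure_lborel_cbox_eq ennreal_indicator divide_ennreal_def)
    then show ?thesis
      unfolding One unit_mean_def using h by (simp add: integral_real_density)
  qed
  finally show ?thesis .
qed

text \<open>The excluded points lie on countably many lines, each of measure zero.\<close>

lemma AE_uniform_nonint:
  fixes A :: "(real ^ 2) set"
  assumes "A \<in> sets borel"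
  shows "AE x in uniform_measure lborel A. x $ 1 \<notin> \<int> \<and> x $ 2 \<notin> \<int>"
proof -
  have "AE x :: real ^ 2 in lborel. x $ i \<notin> \<int>" for i :: 2
  proof -
    have "AE x :: real ^ 2 in lborel. \<forall>k::int. axis i 1 \<bullet> x \<noteq> real_of_int k"
      unfolding AE_all_countable by (intro allI AE_lborel_inner_neq) (simp add: axis_eq_0_iff)
    then show ?thesis by eventually_elim (auto simp: inner_axis' elim!: Ints_cases)
  qed
  from this[of 1] this[of 2] have "AE x :: real ^ 2 in lborel. x $ 1 \<notin> \<int> \<and> x $ 2 \<notin> \<int>"
    by eventually_elim auto
  then show ?thesis using assms by (intro AE_uniform_measureI) auto
qed

theorem theorem1:
  fixes P :: "(real ^ 2) set" and M :: "'a measure" and X :: "'a \<Rightarrow> real ^ 2"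
  assumes "convex_integer_polygon P"
    and "\<And>s t. s \<in> sides P \<Longrightarrow> t \<in> sides P \<Longrightarrow> s \<noteq> t \<Longrightarrow> \<not> parallel_sides s t"
    and "prob_space M"
    and "X \<in> borel_measurable M"
    and "distr M borel X = uniform_measure lborel (cbox 0 1)"
  shows "prob_space.variance M (\<lambda>\<omega>. real (translate_count P (X \<omega>)))
           = (\<Sum>s\<in>sides P. (real (affine_length s))\<^sup>2) / 12"
proof -
  obtain N c where "polygon_normals P N c"
    and hull: "\<And>e. e \<in> sides P \<Longrightarrow> affine hull e = {y. int_vec (N e) \<bullet> y = of_int (c e)}"
    using polygon_normals_exist[OF assms(1)] by blast
  then interpret polygon_normals P N c by simp
  define S where "S x = (\<Sum>e\<in>sides P. real (affine_length e) * sawtooth (int_vec (N e) \<bullet> x))" for x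
  have [measurable]: "S \<in> borel_measurable borel" unfolding S_def[abs_def] by measurable
  have [measurable]: "translate_count P \<in> measurable borel (count_space UNIV)"
    by (rule measurable_translate_count) (rule polytope_imp_closed[OF poly])
  note [measurable] = assms(4)
  obtain C where "\<forall>x. x $ 1 \<notin> \<int> \<and> x $ 2 \<notin> \<int> \<longrightarrow> real (translate_count P x) + S x = C"
    using count_plus_sawtooth_const unfolding S_def by blast
  then have C: "real (translate_count P x) = C - S x" if "x $ 1 \<notin> \<int> \<and> x $ 2 \<notin> \<int>" for x
    using that by (simp add: eq_diff_eq)
  have "AE x :: real ^ 2 in uniform_measure lborel (cbox 0 1). x $ 1 \<notin> \<int> \<and> x $ 2 \<notin> (\<int> :: real set)"
    by (rule AE_uniform_nonint) simp
  then have "AE x in distr M borel X. real (translate_count P x) = C - S x"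
    unfolding assms(5) by eventually_elim (rule C)
  \<comment> \<open>Almost surely the count is a constant minus the sawtooth sum, so only the first
    two moments of \<open>S\<close> remain to be found.\<close>
  then have AE: "AE \<omega> in M. real (translate_count P (X \<omega>)) = C - S (X \<omega>)"
    by (rule AE_distrD[OF assms(4)])
  have ne: "int_vec (N e) \<noteq> 0" if "e \<in> sides P" for e
    using coprime_normal[OF that] by (auto simp: vec_eq_iff forall_2)
  have int: "int_vec (N e) \<bullet> b \<in> \<int>" if "b \<in> Basis" for e b
    using that by (auto simp: Basis_vec_def inner_axis)
  have dual: "\<exists>v. int_vec (N e) \<bullet> v = 0 \<and> int_vec (N e') \<bullet> v = 1"
    if "e \<in> sides P" "e' \<in> sides P" "e \<noteq> e'" for e e'
    using nonparallel_dual[OF coprime_normal coprime_normal hull hull assms(2)] that by blast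
  have mS: "unit_mean S = 0" "unit_mean (\<lambda>x. (S x)\<^sup>2) = (\<Sum>s\<in>sides P. (real (affine_length s))\<^sup>2) / 12"
    unfolding S_def[abs_def]
    by (rule unit_mean_sawtooth_sum_square[OF finite_sides]; use ne int dual in blast)+
  have intS: "integrable M (\<lambda>\<omega>. S (X \<omega>))"
  proof (rule finite_measure.integrable_const_bound)
    show "finite_measure M" using assms(3) by (simp add: prob_space_def)
    have "\<bar>S x\<bar> \<le> (\<Sum>e\<in>sides P. real (affine_length e))" for x
      unfolding S_def by (rule order_trans[OF sum_abs])
        (auto intro!: sum_mono simp: abs_mult abs_sawtooth_le mult_left_le)
    then show "AE \<omega> in M. norm (S (X \<omega>)) \<le> (\<Sum>e\<in>sides P. real (affine_length e))" by simp
  qed measurable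
  have "(\<integral>\<omega>. real (translate_count P (X \<omega>)) \<partial>M) = (\<integral>\<omega>. C - S (X \<omega>) \<partial>M)"
    using AE by (intro integral_cong_AE) auto
  also have "\<dots> = C - (\<integral>\<omega>. S (X \<omega>) \<partial>M)"
    using intS prob_space.prob_space[OF assms(3)] assms(3)
    by (subst Bochner_Integration.integral_diff) (auto simp: prob_space_def finite_measure.integrable_const)
  also have "(\<integral>\<omega>. S (X \<omega>) \<partial>M) = 0"
    using expectation_unit_mean[OF assms(4,5), of S] mS by simp
  finally have mean: "(\<integral>\<omega>. real (translate_count P (X \<omega>)) \<partial>M) = C" by simp
  \<comment> \<open>\<open>S\<close> is centred, so \<open>C\<close> is the expectation, and the
    deviation from it is \<open>- S (X \<omega>)\<close> almost surely.\<close>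
  have "(\<integral>\<omega>. (real (translate_count P (X \<omega>)) - C)\<^sup>2 \<partial>M) = (\<integral>\<omega>. (S (X \<omega>))\<^sup>2 \<partial>M)"
    using AE by (intro integral_cong_AE) (auto elim!: eventually_mono)
  also have "\<dots> = unit_mean (\<lambda>x. (S x)\<^sup>2)"
    by (rule expectation_unit_mean[OF assms(4,5)]) measurable
  finally show ?thesis by (simp add: mean mS)
qed

end
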